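(* Let $\mathcal H$ be a finite collection of hyperplanes in $\mathbb R^n$ such that every edge of the $n$-dimensional hypercube $\{\pm 1\}^n$ is sliced by some hyperplane in $\mathcal H$. Then for all sufficiently large $n$, \[|\mathcal H| > \frac{n^{13/19}}{10^{11}\log^{32/19}n}.\]
   Context: The $n$-dimensional hypercube has vertex set $\{\pm1\}^n$, with an edge between two vertices differing in exactly one coordinate. A hyperplane $H=\{x\in\mathbb R^n : \langle a,x\rangle=b\}$ slices the edge $vv'$ if $\langle a,v\rangle-b$ and $\langle a,v'\rangle-b$ are both nonzero and have different signs (equivalently, $H$ contains exactly one interior point of the edge). Logarithms are natural. *)

theory Defs
  imports Complex_Main "Jordan_Normal_Form.Matrix"
begin

text \<open>The dimension \<open>n\<close> is quantified inside the theorem, so \<open>\<real>\<^sup>n\<close> is the explicit carrier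
  \<^term>\<open>carrier_vec n :: real vec set\<close>, with coordinates indexed by \<open>0, \<dots>, n - 1\<close>.\<close>

definition hyperplane :: "nat \<Rightarrow> real vec \<Rightarrow> real \<Rightarrow> real vec set" where
  "hyperplane n a b = {x \<in> carrier_vec n. a \<bullet> x = b}"

definition is_hyperplane :: "nat \<Rightarrow> real vec set \<Rightarrow> bool" where
  "is_hyperplane n H \<longleftrightarrow> (\<exists>a b. a \<in> carrier_vec n \<and> a \<noteq> 0\<^sub>v n \<and> H = hyperplane n a b)"

definition cube_vertices :: "nat \<Rightarrow> real vec set" where
  "cube_vertices n = {v \<in> carrier_vec n. \<forall>i<n. v $ i = 1 \<or> v $ i = -1}"

definition cube_edge :: "nat \<Rightarrow> real vec \<Rightarrow> real vec \<Rightarrow> bool" where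
  "cube_edge n v v' \<longleftrightarrow>
     v \<in> cube_vertices n \<and> v' \<in> cube_vertices n \<and> card {i. i < n \<and> v $ i \<noteq> v' $ i} = 1"

text \<open>A hyperplane is a set of points, and slicing is defined via an equation for it; by
  \<open>slices_hyperplane_iff\<close> below, the choice of the equation does not matter.\<close>

definition slices :: "nat \<Rightarrow> real vec set \<Rightarrow> real vec \<Rightarrow> real vec \<Rightarrow> bool" where
  "slices n H v v' \<longleftrightarrow>
     (\<exists>a b. a \<in> carrier_vec n \<and> a \<noteq> 0\<^sub>v n \<and> H = hyperplane n a b \<and>
        a \<bullet> v - b \<noteq> 0 \<and> a \<bullet> v' - b \<noteq> 0 \<and> sgn (a \<bullet> v - b) \<noteq> sgn (a \<bullet> v' - b))"

definition slices_all_cube_edges :: "nat \<Rightarrow> real vec set set \<Rightarrow> bool" where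
  "slices_all_cube_edges n \<H> \<longleftrightarrow> (\<forall>v v'. cube_edge n v v' \<longrightarrow> (\<exists>H\<in>\<H>. slices n H v v'))"

lemma self_scalar_prod_pos:
  fixes a :: "real vec"
  assumes a: "a \<in> carrier_vec n" and nz: "a \<noteq> 0\<^sub>v n"
  shows "a \<bullet> a > 0"
proof -
  from a nz obtain i where i: "i < n" "a $ i \<noteq> 0"
    by (metis carrier_vecD eq_vecI index_zero_vec)
  have "(\<Sum>j\<in>{0..<n}. a $ j * a $ j) > 0"
    by (rule sum_pos2[of _ i]) (use i in \<open>auto simp: zero_less_mult_iff\<close>)
  then show ?thesis using a by (simp add: scalar_prod_def)
qed

lemma hyperplane_eq_proportional:
  assumes a: "a \<in> carrier_vec n" "a \<noteq> 0\<^sub>v n"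
    and a': "a' \<in> carrier_vec n" "a' \<noteq> 0\<^sub>v n"
    and eq: "hyperplane n a b = hyperplane n a' b'"
  obtains c where "c \<noteq> 0" "\<And>x. x \<in> carrier_vec n \<Longrightarrow> a' \<bullet> x - b' = c * (a \<bullet> x - b)"
proof -
  have pos: "a \<bullet> a > 0" and pos': "a' \<bullet> a' > 0"
    using a a' self_scalar_prod_pos by auto
  define c where "c = (a' \<bullet> a) / (a \<bullet> a)"
  have c: "a' \<bullet> x - b' = c * (a \<bullet> x - b)" if x: "x \<in> carrier_vec n" for x
  proof -
    define t where "t = (a \<bullet> x - b) / (a \<bullet> a)"
    have y: "x - t \<cdot>\<^sub>v a \<in> carrier_vec n" using x a by simp
    have prod: "d \<bullet> (x - t \<cdot>\<^sub>v a) = d \<bullet> x - t * (d \<bullet> a)" if "d \<in> carrier_vec n" for d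
      using that x a by (simp add: scalar_prod_minus_distrib[of _ n])
    have "a \<bullet> (x - t \<cdot>\<^sub>v a) = b"
      using prod[OF a(1)] pos by (simp add: t_def)
    then have "a' \<bullet> (x - t \<cdot>\<^sub>v a) = b'"
      using y eq by (auto simp: hyperplane_def)
    then show ?thesis
      using prod[OF a'(1)] by (simp add: t_def c_def algebra_simps)
  qed
  have "c \<noteq> 0"
  proof
    assume "c = 0"
    then have "a' \<bullet> a' = b'" "a' \<bullet> 0\<^sub>v n = b'"
      using c[of a'] c[of "0\<^sub>v n"] a' by auto
    then show False using pos' a' by simp
  qed
  with c show thesis using that by blast
qed

lemma slices_hyperplane_iff:
  assumes a: "a \<in> carrier_vec n" "a \<noteq> 0\<^sub>v n"
    and v: "v \<in> carrier_vec n" "v' \<in> carrier_vec n"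
  shows "slices n (hyperplane n a b) v v' \<longleftrightarrow>
    a \<bullet> v - b \<noteq> 0 \<and> a \<bullet> v' - b \<noteq> 0 \<and> sgn (a \<bullet> v - b) \<noteq> sgn (a \<bullet> v' - b)"
    (is "?L \<longleftrightarrow> ?R")
proof
  assume ?L
  then obtain a' b' where a': "a' \<in> carrier_vec n" "a' \<noteq> 0\<^sub>v n"
    and eq: "hyperplane n a b = hyperplane n a' b'"
    and s: "a' \<bullet> v - b' \<noteq> 0" "a' \<bullet> v' - b' \<noteq> 0" "sgn (a' \<bullet> v - b') \<noteq> sgn (a' \<bullet> v' - b')"
    unfolding slices_def by auto
  obtain c where "c \<noteq> 0" "\<And>x. x \<in> carrier_vec n \<Longrightarrow> a' \<bullet> x - b' = c * (a \<bullet> x - b)"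
    using hyperplane_eq_proportional[OF a a' eq] by blast
  with s v show ?R by (simp only: sgn_mult) auto
next
  assume ?R
  then show ?L unfolding slices_def using a by blast
qed

end

theory Submission
  imports "HOL-Probability.Hoeffding" "HOL-Real_Asymp.Real_Asymp" Defs
begin

text \<open>
  Suppose that \<open>k\<close> hyperplanes slice all edges. After deleting at most half of the coordinates, the
  hyperplanes that matter can be normalized to unit vectors \<open>v\<^sub>i\<close> such that all coordinates carry a
  comparable share of the total mass \<open>k\<close>; the others are kept away from the remaining subcube by the
  choice of the deleted coordinates.

  If \<open>p\<close> is a point of \<open>[-1/2, 1/2]\<^sup>S\<close> and \<open>X\<close> is a random vertex with mean \<open>p\<close>, then a hyperplane at
  distance more than about \<open>\<surd>(ln n)\<close> from \<open>p\<close> slices no edge at \<open>X\<close> with high probability, and any other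
  one slices \<open>O(\<surd>n)\<close> edges at \<open>X\<close> on average. Hence at least of the order of \<open>\<surd>n\<close> hyperplanes are near
  to \<open>p\<close>, for every \<open>p\<close>.

  On the other hand, run a random walk along the directions \<open>v\<^sub>j\<close> with independent signs, for time
  \<open>T\<close> about \<open>n / k\<close>, so that it stays in the cube. Multiply the step along \<open>v\<^sub>j\<close> by a huge
  factor while the walk is near the \<open>j\<close>-th hyperplane, unless the sum of the squared correlations of \<open>v\<^sub>j\<close>
  with all \<open>v\<^sub>i\<close> exceeds about \<open>T\<close>. The time spent near a hyperplane, weighted with the variance of the
  walk across it, is at most about the square root of the total variance across it. It follows that the
  boosted hyperplanes are almost never near, and each other one is near for a fraction of about \<open>1 / T\<close> of
  the time. So some \<open>p\<close> has only about \<open>k\<^sup>2 / n\<close> near hyperplanes, whence \<open>k\<close> is at least about \<open>n\<^bsup>3/4\<^esup>\<close> up to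
  logarithms, which exceeds \<open>n\<^bsup>13/19\<^esup>\<close>.
\<close>

section \<open>Signs with independent biases\<close>

text \<open>A cube vertex is encoded as the set \<open>X\<close> of its positive coordinates.
  Coordinates outside \<open>X\<close> get sign -1, so flipping a sign is inserting or removing an
  element.\<close>

definition sg :: "'a set \<Rightarrow> 'a \<Rightarrow> real" where
  "sg X l = (if l \<in> X then 1 else -1)"

text \<open>The expectation of \<open>F X\<close> for independent signs \<open>sg X l\<close> with
  means \<open>p l\<close>, written as a finite weighted sum. Its linear identities hold for every
  real \<open>p\<close>; the bounds \<bar>p l\<bar> \<le> 1 enter through the positivity of the
  weights.\<close>

definition pexp :: "('a \<Rightarrow> real) \<Rightarrow> 'a set \<Rightarrow> ('a set \<Rightarrow> real) \<Rightarrow> real" where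
  "pexp p A F = (\<Sum>X\<in>Pow A. (\<Prod>l\<in>A. (1 + p l * sg X l) / 2) * F X)"

lemma pexp_empty [simp]: "pexp p {} F = F {}"
  by (simp add: pexp_def)

text \<open>Conditioning on the sign of \<open>a\<close>. Together with the value on the empty set
  this is the recursion behind the inductions on \<open>A\<close>.\<close>

lemma pexp_insert:
  assumes "finite A" "a \<notin> A"
  shows "pexp p (insert a A) F =
    (1 + p a) / 2 * pexp p A (\<lambda>X. F (insert a X)) + (1 - p a) / 2 * pexp p A F"
proof -
  have inj: "inj_on (insert a) (Pow A)"
    using assms by (auto simp: inj_on_def)
  have disj: "Pow A \<inter> insert a ` Pow A = {}"
    using assms by auto
  have 1: "(\<Prod>l\<in>insert a A. (1 + p l * sg X l) / 2) = (1 - p a) / 2 * (\<Prod>l\<in>A. (1 + p l * sg X l) / 2)"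
    if "X \<in> Pow A" for X
    using assms that by (subst prod.insert) (auto simp: sg_def)
  have 2: "(\<Prod>l\<in>insert a A. (1 + p l * sg (insert a X) l) / 2) =
      (1 + p a) / 2 * (\<Prod>l\<in>A. (1 + p l * sg X l) / 2)" if "X \<in> Pow A" for X
  proof -
    have "(\<Prod>l\<in>A. (1 + p l * sg (insert a X) l) / 2) = (\<Prod>l\<in>A. (1 + p l * sg X l) / 2)"
      using assms by (intro prod.cong) (auto simp: sg_def)
    then show ?thesis using assms by (subst prod.insert) (auto simp: sg_def)
  qed
  have "pexp p (insert a A) F =
      (\<Sum>X\<in>Pow A. (\<Prod>l\<in>insert a A. (1 + p l * sg X l) / 2) * F X) +
      (\<Sum>X\<in>Pow A. (\<Prod>l\<in>insert a A. (1 + p l * sg (insert a X) l) / 2) * F (insert a X))"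
    unfolding pexp_def Pow_insert using assms(1)
    by (subst sum.union_disjoint) (auto simp only: disj sum.reindex[OF inj] o_def finite_Pow_iff finite_imageI)
  also have "\<dots> = (\<Sum>X\<in>Pow A. (1 - p a) / 2 * ((\<Prod>l\<in>A. (1 + p l * sg X l) / 2) * F X)) +
      (\<Sum>X\<in>Pow A. (1 + p a) / 2 * ((\<Prod>l\<in>A. (1 + p l * sg X l) / 2) * F (insert a X)))"
    by (intro arg_cong2[where f="(+)"] sum.cong refl) (simp_all only: 1 2 mult.assoc)
  finally show ?thesis
    unfolding pexp_def by (simp only: sum_distrib_left add.commute)
qed

lemma pexp_cong:
  assumes "\<And>X. X \<subseteq> A \<Longrightarrow> F X = G X"
  shows "pexp p A F = pexp p A G"
  using assms by (auto simp: pexp_def intro!: sum.cong)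

lemma pexp_const: "finite A \<Longrightarrow> pexp p A (\<lambda>_. c) = c"
proof (induction A rule: finite_induct)
  case (insert a A)
  show ?case
    unfolding pexp_insert[OF insert(1,2)] insert.IH by (simp add: field_simps)
qed simp

lemma pexp_add: "pexp p A (\<lambda>X. F X + G X) = pexp p A F + pexp p A G"
  by (simp add: pexp_def algebra_simps sum.distrib)

lemma pexp_diff: "pexp p A (\<lambda>X. F X - G X) = pexp p A F - pexp p A G"
  by (simp add: pexp_def algebra_simps sum_subtractf)

lemma pexp_cmult: "pexp p A (\<lambda>X. c * F X) = c * pexp p A F"
  by (simp add: pexp_def sum_distrib_left mult_ac)

lemma pexp_sum: "pexp p A (\<lambda>X. \<Sum>i\<in>I. F i X) = (\<Sum>i\<in>I. pexp p A (F i))"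
  by (simp add: pexp_def sum_distrib_left) (rule sum.swap)

lemma pexp_mono:
  assumes "\<And>l. l \<in> A \<Longrightarrow> \<bar>p l\<bar> \<le> 1" "\<And>X. X \<subseteq> A \<Longrightarrow> F X \<le> G X"
  shows "pexp p A F \<le> pexp p A G"
proof -
  have "0 \<le> (1 + p l * sg X l) / 2" if "l \<in> A" for l X
    using assms(1)[OF that] by (auto simp: sg_def)
  then show ?thesis
    unfolding pexp_def using assms by (intro sum_mono mult_left_mono prod_nonneg) auto
qed

lemma pexp_le_const:
  assumes "finite A" "\<And>l. l \<in> A \<Longrightarrow> \<bar>p l\<bar> \<le> 1" "\<And>X. X \<subseteq> A \<Longrightarrow> F X \<le> c"
  shows "pexp p A F \<le> c"
  using pexp_mono[of A p F "\<lambda>_. c"] assms by (simp add: pexp_const)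

lemma pexp_ge_const:
  assumes "finite A" "\<And>l. l \<in> A \<Longrightarrow> \<bar>p l\<bar> \<le> 1" "\<And>X. X \<subseteq> A \<Longrightarrow> c \<le> F X"
  shows "c \<le> pexp p A F"
  using pexp_mono[of A p "\<lambda>_. c" F] assms by (simp add: pexp_const)

lemma pexp_Un:
  assumes "finite A" "finite B" "A \<inter> B = {}"
  shows "pexp p (A \<union> B) F = pexp p A (\<lambda>X. pexp p B (\<lambda>Y. F (X \<union> Y)))"
  using assms
proof (induction A arbitrary: F rule: finite_induct)
  case (insert a A)
  have "pexp p (insert a A \<union> B) F = pexp p (insert a (A \<union> B)) F" by simp
  also have "\<dots> = (1 + p a) / 2 * pexp p (A \<union> B) (\<lambda>X. F (insert a X)) + (1 - p a) / 2 * pexp p (A \<union> B) F"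
    using insert by (intro pexp_insert) auto
  finally show ?case using insert by (simp add: pexp_insert)
qed simp

lemma sum_sg_insert:
  assumes "finite A" "a \<notin> A"
  shows "(\<Sum>l\<in>A. f l (sg (insert a X) l)) = (\<Sum>l\<in>A. f l (sg X l))"
  using assms by (intro sum.cong) (auto simp: sg_def)

section \<open>Moments and tails of weighted sums of centered signs\<close>

lemma pexp_linear:
  assumes "finite A"
  shows "pexp p A (\<lambda>X. t + (\<Sum>l\<in>A. c l * (sg X l - p l))) = t"
  using assms
proof (induction A arbitrary: t rule: finite_induct)
  case (insert a A)
  have 1: "t + (\<Sum>l\<in>insert a A. c l * (sg (insert a X) l - p l)) =
      (t + c a * (1 - p a)) + (\<Sum>l\<in>A. c l * (sg X l - p l))" if "X \<subseteq> A" for X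
    using insert sum_sg_insert[OF insert(1,2), of "\<lambda>l s. c l * (s - p l)" X] by (simp add: sg_def)
  have 2: "t + (\<Sum>l\<in>insert a A. c l * (sg X l - p l)) =
      (t + c a * (-1 - p a)) + (\<Sum>l\<in>A. c l * (sg X l - p l))" if "X \<subseteq> A" for X
  proof -
    have "a \<notin> X" using that insert by auto
    then show ?thesis using insert by (simp add: sg_def)
  qed
  have 3: "pexp p A (\<lambda>X. t + (\<Sum>l\<in>insert a A. c l * (sg (insert a X) l - p l))) = t + c a * (1 - p a)"
    by (subst insert.IH[symmetric], rule pexp_cong, erule 1)
  have 4: "pexp p A (\<lambda>X. t + (\<Sum>l\<in>insert a A. c l * (sg X l - p l))) = t + c a * (-1 - p a)"
    by (subst insert.IH[symmetric], rule pexp_cong, erule 2)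
  show ?case
    unfolding pexp_insert[OF insert(1,2)] 3 4 by (simp add: field_simps)
qed simp

text \<open>The centered signs are orthogonal with variances \<open>1 - (p l)\<^sup>2\<close>. The
  free offset \<open>t\<close> carries the induction, since conditioning on one more sign shifts
  it.\<close>

lemma pexp_square:
  assumes "finite A"
  shows "pexp p A (\<lambda>X. (t + (\<Sum>l\<in>A. c l * (sg X l - p l)))\<^sup>2) = t\<^sup>2 + (\<Sum>l\<in>A. (c l)\<^sup>2 * (1 - (p l)\<^sup>2))"
  using assms
proof (induction A arbitrary: t rule: finite_induct)
  case (insert a A)
  have 1: "(t + (\<Sum>l\<in>insert a A. c l * (sg (insert a X) l - p l)))\<^sup>2 =
      ((t + c a * (1 - p a)) + (\<Sum>l\<in>A. c l * (sg X l - p l)))\<^sup>2" if "X \<subseteq> A" for X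
    using insert sum_sg_insert[OF insert(1,2), of "\<lambda>l s. c l * (s - p l)" X] by (simp add: sg_def add.assoc)
  have 2: "(t + (\<Sum>l\<in>insert a A. c l * (sg X l - p l)))\<^sup>2 =
      ((t + c a * (-1 - p a)) + (\<Sum>l\<in>A. c l * (sg X l - p l)))\<^sup>2" if "X \<subseteq> A" for X
  proof -
    have "a \<notin> X" using that insert by auto
    then show ?thesis using insert by (simp add: sg_def add.assoc)
  qed
  have 3: "pexp p A (\<lambda>X. (t + (\<Sum>l\<in>insert a A. c l * (sg (insert a X) l - p l)))\<^sup>2)
      = (t + c a * (1 - p a))\<^sup>2 + (\<Sum>l\<in>A. (c l)\<^sup>2 * (1 - (p l)\<^sup>2))"
    by (subst insert.IH[symmetric], rule pexp_cong, erule 1)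
  have 4: "pexp p A (\<lambda>X. (t + (\<Sum>l\<in>insert a A. c l * (sg X l - p l)))\<^sup>2)
      = (t + c a * (-1 - p a))\<^sup>2 + (\<Sum>l\<in>A. (c l)\<^sup>2 * (1 - (p l)\<^sup>2))"
    by (subst insert.IH[symmetric], rule pexp_cong, erule 2)
  show ?case
    unfolding pexp_insert[OF insert(1,2)] 3 4 unfolding sum.insert[OF insert(1,2)]
    by (simp add: field_simps power2_eq_square)
qed simp

text \<open>Hoeffding's lemma for a centered sign of mean \<open>p\<close>. The case of negative
  \<open>c\<close> follows by changing the signs of both \<open>c\<close> and
  \<open>p\<close>.\<close>

lemma two_point_mgf_le:
  fixes p c :: real
  assumes "\<bar>p\<bar> \<le> 1"
  shows "(1 + p) / 2 * exp (c * (1 - p)) + (1 - p) / 2 * exp (c * (-1 - p)) \<le> exp (c\<^sup>2 / 2)"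
proof -
  have *: "(1 + p) / 2 * exp (c * (1 - p)) + (1 - p) / 2 * exp (c * (-1 - p)) \<le> exp (c\<^sup>2 / 2)"
    if "c \<ge> 0" "\<bar>p\<bar> \<le> 1" for p c :: real
  proof -
    define q where "q = (1 + p) / 2"
    have q: "0 \<le> q" "q \<le> 1" using that by (auto simp: q_def)
    have pos: "1 + q * (exp (2 * c) - 1) > 0"
      using q that by (intro add_pos_nonneg mult_nonneg_nonneg) auto
    have "(1 + p) / 2 * exp (c * (1 - p)) + (1 - p) / 2 * exp (c * (-1 - p))
        = exp (- (2 * c) * q) * (1 + q * (exp (2 * c) - 1))"
    proof -
      have e: "exp (c * (1 - p)) = exp (- (2 * c) * q) * exp (2 * c)"
        "exp (c * (-1 - p)) = exp (- (2 * c) * q)"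
        by (simp_all add: exp_add[symmetric] q_def field_simps)
      have q': "(1 + p) / 2 = q" "(1 - p) / 2 = 1 - q"
        by (simp_all add: q_def field_simps)
      show ?thesis unfolding e q' by (simp add: algebra_simps)
    qed
    also have "\<dots> = exp (- (2 * c) * q + ln (1 + q * (exp (2 * c) - 1)))"
      unfolding exp_add using pos by simp
    also have "\<dots> \<le> exp ((2 * c)\<^sup>2 / 8)"
      using Hoeffdings_lemma_aux[of "2 * c" q] that q by simp
    finally show ?thesis by (simp add: power2_eq_square)
  qed
  show ?thesis
  proof (cases "c \<ge> 0")
    case True
    then show ?thesis using * assms by blast
  next
    case False
    then show ?thesis using *[of "-c" "-p"] assms by (simp add: algebra_simps)
  qed
qed

text \<open>By independence the exponential moment is a product of the two-point moments.\<close>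

lemma pexp_exp_le:
  assumes "finite A" "\<And>l. l \<in> A \<Longrightarrow> \<bar>p l\<bar> \<le> 1"
  shows "pexp p A (\<lambda>X. exp (\<Sum>l\<in>A. c l * (sg X l - p l))) \<le> exp ((\<Sum>l\<in>A. (c l)\<^sup>2) / 2)"
  using assms
proof (induction A rule: finite_induct)
  case (insert a A)
  let ?E = "\<lambda>X. exp (\<Sum>l\<in>A. c l * (sg X l - p l))"
  have 1: "exp (\<Sum>l\<in>insert a A. c l * (sg (insert a X) l - p l)) = exp (c a * (1 - p a)) * ?E X"
    if "X \<subseteq> A" for X
    using insert sum_sg_insert[OF insert(1,2), of "\<lambda>l s. c l * (s - p l)" X]
    by (simp add: sg_def exp_add)
  have 2: "exp (\<Sum>l\<in>insert a A. c l * (sg X l - p l)) = exp (c a * (-1 - p a)) * ?E X" if "X \<subseteq> A" for X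
  proof -
    have "a \<notin> X" using that insert by auto
    then show ?thesis using insert by (simp add: sg_def exp_add)
  qed
  have IH: "pexp p A ?E \<le> exp ((\<Sum>l\<in>A. (c l)\<^sup>2) / 2)"
    using insert by auto
  have "pexp p (insert a A) (\<lambda>X. exp (\<Sum>l\<in>insert a A. c l * (sg X l - p l)))
      = (1 + p a) / 2 * pexp p A (\<lambda>X. exp (c a * (1 - p a)) * ?E X) +
        (1 - p a) / 2 * pexp p A (\<lambda>X. exp (c a * (-1 - p a)) * ?E X)"
    unfolding pexp_insert[OF insert(1,2)]
    by (intro arg_cong2[where f="(+)"] arg_cong2[where f="(*)"] refl pexp_cong 1 2)
  also have "\<dots> = ((1 + p a) / 2 * exp (c a * (1 - p a)) + (1 - p a) / 2 * exp (c a * (-1 - p a))) * pexp p A ?E"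
    by (simp only: pexp_cmult) (simp add: algebra_simps)
  also have "\<dots> \<le> exp ((c a)\<^sup>2 / 2) * exp ((\<Sum>l\<in>A. (c l)\<^sup>2) / 2)"
    using insert IH
    by (intro mult_mono two_point_mgf_le pexp_ge_const) auto
  also have "\<dots> = exp ((\<Sum>l\<in>insert a A. (c l)\<^sup>2) / 2)"
    using insert by (simp add: exp_add[symmetric] add_divide_distrib)
  finally show ?case .
qed simp

lemma pexp_exists_le:
  assumes "finite A" "\<And>l. l \<in> A \<Longrightarrow> \<bar>p l\<bar> \<le> 1"
  obtains X where "X \<subseteq> A" "F X \<le> pexp p A F"
proof -
  obtain X where X: "X \<in> Pow A" "\<And>Y. Y \<in> Pow A \<Longrightarrow> F X \<le> F Y"
    using assms(1) arg_min_if_finite(1)[of "Pow A" F] arg_min_least[of "Pow A" _ F]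
    by (metis Pow_not_empty finite_Pow_iff)
  then have "F X \<le> pexp p A F"
    using assms by (intro pexp_ge_const) auto
  with X show thesis using that by auto
qed

lemma abs_le_add_square:
  fixes x s :: real
  assumes "s > 0"
  shows "\<bar>x\<bar> \<le> s / 2 + x\<^sup>2 / (2 * s)"
proof -
  have "0 \<le> (s - \<bar>x\<bar>)\<^sup>2" by simp
  then have "2 * s * \<bar>x\<bar> \<le> s\<^sup>2 + x\<^sup>2" by (simp add: power2_diff)
  then show ?thesis using assms by (simp add: field_simps power2_eq_square)
qed

text \<open>The second moment bounds the first; the inequality of \<open>abs_le_add_square\<close>
  stands in for Cauchy-Schwarz.\<close>

lemma pexp_abs_le:
  assumes "finite A" "\<And>l. l \<in> A \<Longrightarrow> \<bar>p l\<bar> \<le> 1" "s > 0" "(\<Sum>l\<in>A. (c l)\<^sup>2 * (1 - (p l)\<^sup>2)) \<le> s\<^sup>2"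
  shows "pexp p A (\<lambda>X. \<bar>\<Sum>l\<in>A. c l * (sg X l - p l)\<bar>) \<le> s"
proof -
  let ?Y = "\<lambda>X. \<Sum>l\<in>A. c l * (sg X l - p l)"
  have "pexp p A (\<lambda>X. \<bar>?Y X\<bar>) \<le> pexp p A (\<lambda>X. s / 2 + 1 / (2 * s) * (?Y X)\<^sup>2)"
    using assms abs_le_add_square[OF assms(3)] by (intro pexp_mono) auto
  also have "\<dots> = s / 2 + 1 / (2 * s) * (\<Sum>l\<in>A. (c l)\<^sup>2 * (1 - (p l)\<^sup>2))"
    using assms(1) pexp_square[OF assms(1), of p 0 c] by (simp only: pexp_add pexp_cmult pexp_const) simp
  also have "\<dots> \<le> s / 2 + 1 / (2 * s) * s\<^sup>2"
    using assms by (intro add_left_mono mult_left_mono) auto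
  also have "\<dots> = s" using assms by (simp add: field_simps power2_eq_square)
  finally show ?thesis .
qed

text \<open>Chernoff's bound: the exponential moments at \<open>u\<close> and \<open>- u\<close>
  each contribute exp (- u^2) * exp (u^2 / 2).\<close>

lemma pexp_tail_le:
  assumes "finite A" "\<And>l. l \<in> A \<Longrightarrow> \<bar>p l\<bar> \<le> 1" "u \<ge> 0" "(\<Sum>l\<in>A. (c l)\<^sup>2) \<le> 1"
  shows "pexp p A (\<lambda>X. of_bool (\<bar>\<Sum>l\<in>A. c l * (sg X l - p l)\<bar> \<ge> u)) \<le> 2 * exp (- u\<^sup>2 / 2)"
proof -
  let ?Y = "\<lambda>X. \<Sum>l\<in>A. c l * (sg X l - p l)"
  have m: "pexp p A (\<lambda>X. exp (s * ?Y X)) \<le> exp (u\<^sup>2 / 2)" if "s = u \<or> s = - u" for s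
  proof -
    have "pexp p A (\<lambda>X. exp (s * ?Y X)) \<le> exp ((\<Sum>l\<in>A. (s * c l)\<^sup>2) / 2)"
      using pexp_exp_le[OF assms(1,2), where c="\<lambda>l. s * c l"] by (simp add: sum_distrib_left mult.assoc)
    also have "(\<Sum>l\<in>A. (s * c l)\<^sup>2) = u\<^sup>2 * (\<Sum>l\<in>A. (c l)\<^sup>2)"
      using that by (auto simp: sum_distrib_left power_mult_distrib)
    also have "exp (u\<^sup>2 * (\<Sum>l\<in>A. (c l)\<^sup>2) / 2) \<le> exp (u\<^sup>2 / 2)"
      using mult_left_mono[OF assms(4), of "u\<^sup>2"] by simp
    finally show ?thesis .
  qed
  have "of_bool (\<bar>y\<bar> \<ge> u) \<le> exp (- u\<^sup>2) * (exp (u * y) + exp (- u * y))" for y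
  proof (cases "\<bar>y\<bar> \<ge> u")
    case True
    have "u * u \<le> u * \<bar>y\<bar>" using True assms by (intro mult_left_mono) auto
    then have "1 \<le> exp (- u\<^sup>2) * exp (u * \<bar>y\<bar>)"
      by (simp add: exp_add[symmetric] power2_eq_square)
    also have "\<dots> \<le> exp (- u\<^sup>2) * (exp (u * y) + exp (- u * y))"
      by (intro mult_left_mono) (auto simp: abs_if)
    finally show ?thesis using True by simp
  qed (auto intro!: mult_nonneg_nonneg add_nonneg_nonneg)
  then have "pexp p A (\<lambda>X. of_bool (\<bar>?Y X\<bar> \<ge> u)) \<le>
      pexp p A (\<lambda>X. exp (- u\<^sup>2) * (exp (u * ?Y X) + exp (- u * ?Y X)))"
    using assms by (intro pexp_mono) auto
  also have "\<dots> = exp (- u\<^sup>2) * (pexp p A (\<lambda>X. exp (u * ?Y X)) + pexp p A (\<lambda>X. exp (- u * ?Y X)))"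
    by (simp only: pexp_cmult pexp_add)
  also have "\<dots> \<le> exp (- u\<^sup>2) * (exp (u\<^sup>2 / 2) + exp (u\<^sup>2 / 2))"
    by (intro mult_left_mono add_mono m) auto
  also have "\<dots> = 2 * exp (- u\<^sup>2 / 2)"
    by (simp add: exp_add[symmetric] algebra_simps)
  finally show ?thesis .
qed

section \<open>Pivotal coordinates of threshold functions\<close>

text \<open>Discrete integration by parts. Given the other signs, the centered sign is
  \<open>1 - p l\<close> with probability \<open>(1 + p l) / 2\<close> and \<open>- 1 - p l\<close>
  with probability \<open>(1 - p l) / 2\<close>; up to sign both products are
  \<open>(1 - (p l)\<^sup>2) / 2\<close>.\<close>

lemma pexp_pivotal:
  assumes "finite A" "l \<in> A"
  shows "pexp p A (\<lambda>X. f X * (sg X l - p l)) =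
    (1 - (p l)\<^sup>2) / 2 * pexp p A (\<lambda>X. f (insert l X) - f (X - {l}))"
proof -
  obtain B where B: "A = insert l B" "l \<notin> B" using assms(2) by (metis mk_disjoint_insert)
  have fB: "finite B" using assms B by auto
  have 1: "pexp p B (\<lambda>X. f (insert l X) * (sg (insert l X) l - p l)) = (1 - p l) * pexp p B (\<lambda>X. f (insert l X))"
    by (subst pexp_cmult[symmetric], rule pexp_cong) (simp add: sg_def)
  have 2: "pexp p B (\<lambda>X. f X * (sg X l - p l)) = (- 1 - p l) * pexp p B f"
    using B by (subst pexp_cmult[symmetric], intro pexp_cong) (auto simp: sg_def)
  have 3: "pexp p B (\<lambda>X. f (X - {l})) = pexp p B f"
    using B by (intro pexp_cong) (metis Diff_empty Diff_insert0 subset_iff)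
  have 4: "pexp p B (\<lambda>X. f (insert l X - {l})) = pexp p B f"
    using B by (intro pexp_cong) (metis Diff_insert_absorb subset_iff)
  show ?thesis
    unfolding B(1) pexp_diff pexp_insert[OF fB B(2)] 1 2 3 4 insert_absorb2
    by (simp add: field_simps power2_eq_square)
qed

text \<open>Slicing of the edge in direction \<open>l\<close> through \<open>X\<close>: its two ends
  lie strictly on opposite sides of the hyperplane. The value does not depend on whether
  \<open>l\<close> belongs to \<open>X\<close>.\<close>

definition pivotal :: "('a \<Rightarrow> real) \<Rightarrow> real \<Rightarrow> 'a set \<Rightarrow> 'a \<Rightarrow> 'a set \<Rightarrow> bool" where
  "pivotal c b S l X \<longleftrightarrow>
     ((\<Sum>j\<in>S. c j * sg (insert l X) j) - b) * ((\<Sum>j\<in>S. c j * sg (X - {l}) j) - b) < 0"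

lemma sum_sg_flip:
  assumes "finite S" "l \<in> S"
  shows "(\<Sum>j\<in>S. c j * sg (insert l X) j) = (\<Sum>j\<in>S - {l}. c j * sg X j) + c l"
    "(\<Sum>j\<in>S. c j * sg (X - {l}) j) = (\<Sum>j\<in>S - {l}. c j * sg X j) - c l"
proof -
  have "(\<Sum>j\<in>S - {l}. c j * sg (insert l X) j) = (\<Sum>j\<in>S - {l}. c j * sg X j)"
    "(\<Sum>j\<in>S - {l}. c j * sg (X - {l}) j) = (\<Sum>j\<in>S - {l}. c j * sg X j)"
    by (auto intro!: sum.cong simp: sg_def)
  then show "(\<Sum>j\<in>S. c j * sg (insert l X) j) = (\<Sum>j\<in>S - {l}. c j * sg X j) + c l"
    "(\<Sum>j\<in>S. c j * sg (X - {l}) j) = (\<Sum>j\<in>S - {l}. c j * sg X j) - c l"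
    using assms by (simp_all add: sum.remove sg_def)
qed

lemma pivotal_imp_abs_less:
  assumes "finite S" "l \<in> S" "pivotal c b S l X"
  shows "\<bar>(\<Sum>j\<in>S. c j * sg X j) - b\<bar> < 2 * \<bar>c l\<bar>"
proof -
  let ?r = "\<Sum>j\<in>S - {l}. c j * sg X j"
  have "(\<Sum>j\<in>S. c j * sg X j) = ?r + c l * sg X l"
    using assms by (simp add: sum.remove)
  then show ?thesis
    using assms(3) unfolding pivotal_def sum_sg_flip[OF assms(1,2)]
    by (auto simp: mult_less_0_iff sg_def abs_if)
qed

text \<open>The expected number of pivotal coordinates of a threshold function is, up to the factors
  \<open>1 - p\<^sub>l\<^sup>2\<close>, its correlation with a signed sum of the centered coordinates, which are orthogonal.\<close>

lemma expected_pivotal_le: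
  assumes "finite S" "\<And>l. l \<in> S \<Longrightarrow> \<bar>p l\<bar> \<le> 1 / 2"
  shows "(\<Sum>l\<in>S. pexp p S (\<lambda>X. of_bool (pivotal c b S l X))) \<le> 3 * sqrt (card S)"
proof (cases "S = {}")
  case False
  define f where "f X = (of_bool ((\<Sum>j\<in>S. c j * sg X j) > b) :: real)" for X
  \<comment> \<open>The quotient cancels the factor in \<open>pexp_pivotal\<close>, and the sign of
    \<open>c l\<close> makes every pivotal flip count as 1.\<close>
  define d where "d l = 2 / (1 - (p l)\<^sup>2) * sgn (c l)" for l
  have p1: "\<bar>p l\<bar> \<le> 1" if "l \<in> S" for l using assms(2)[OF that] by simp
  have p2: "1 - (p l)\<^sup>2 \<ge> 3 / 4" if "l \<in> S" for l
    using abs_le_square_iff[of "p l" "1/2"] assms(2)[OF that] by (simp add: power2_eq_square)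
  have piv: "of_bool (pivotal c b S l X) \<le> sgn (c l) * (f (insert l X) - f (X - {l}))" if "l \<in> S" for l X
    unfolding f_def pivotal_def sum_sg_flip[OF assms(1) that]
    by (auto simp: mult_less_0_iff sgn_if)
  have "(\<Sum>l\<in>S. pexp p S (\<lambda>X. of_bool (pivotal c b S l X))) \<le>
      (\<Sum>l\<in>S. pexp p S (\<lambda>X. sgn (c l) * (f (insert l X) - f (X - {l}))))"
    using p1 piv by (intro sum_mono pexp_mono) auto
  also have "\<dots> = (\<Sum>l\<in>S. pexp p S (\<lambda>X. f X * (d l * (sg X l - p l))))"
  proof (intro sum.cong refl)
    fix l assume l: "l \<in> S"
    have "pexp p S (\<lambda>X. f X * (d l * (sg X l - p l))) = d l * pexp p S (\<lambda>X. f X * (sg X l - p l))"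
      by (subst pexp_cmult[symmetric]) (simp add: mult_ac)
    also have "\<dots> = sgn (c l) * pexp p S (\<lambda>X. f (insert l X) - f (X - {l}))"
      unfolding pexp_pivotal[OF assms(1) l] d_def using p2[OF l] by simp
    finally show "pexp p S (\<lambda>X. sgn (c l) * (f (insert l X) - f (X - {l}))) = pexp p S (\<lambda>X. f X * (d l * (sg X l - p l)))"
      by (simp only: pexp_cmult)
  qed
  also have "\<dots> = pexp p S (\<lambda>X. f X * (\<Sum>l\<in>S. d l * (sg X l - p l)))"
    by (simp only: pexp_sum[symmetric] sum_distrib_left)
  also have "\<dots> \<le> pexp p S (\<lambda>X. \<bar>\<Sum>l\<in>S. d l * (sg X l - p l)\<bar>)"
    using p1 by (intro pexp_mono) (auto simp: f_def)
  also have "\<dots> \<le> 3 * sqrt (card S)"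
  proof (intro pexp_abs_le assms(1) p1)
    \<comment> \<open>Each term is at most 4 / (3/4) = 16/3, rounded up to 9 for the sake of a
      square.\<close>
    have "(\<Sum>l\<in>S. (d l)\<^sup>2 * (1 - (p l)\<^sup>2)) \<le> (\<Sum>l\<in>S. 9)"
    proof (intro sum_mono)
      fix l assume l: "l \<in> S"
      have "(d l)\<^sup>2 * (1 - (p l)\<^sup>2) = 4 / (1 - (p l)\<^sup>2) * (sgn (c l))\<^sup>2"
        using p2[OF l] by (simp add: d_def power_mult_distrib power_divide power2_eq_square[of "1 - (p l)\<^sup>2"])
      also have "\<dots> \<le> 4 / (3 / 4) * 1"
        using p2[OF l] by (intro mult_mono divide_left_mono) (auto simp: sgn_if)
      finally show "(d l)\<^sup>2 * (1 - (p l)\<^sup>2) \<le> 9" by simp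
    qed
    then show "(\<Sum>l\<in>S. (d l)\<^sup>2 * (1 - (p l)\<^sup>2)) \<le> (3 * sqrt (card S))\<^sup>2"
      by (simp add: power_mult_distrib)
  qed (use False assms in \<open>auto simp: card_gt_0_iff\<close>)
  finally show ?thesis .
qed simp


section \<open>Removing dominant coordinates\<close>

definition sqsum :: "('l \<Rightarrow> real) \<Rightarrow> 'l set \<Rightarrow> real" where
  "sqsum a S = (\<Sum>l\<in>S. (a l)\<^sup>2)"

text \<open>The sum of the relative losses of squared norm when the listed coordinates are deleted one
  after the other; a loss relative to a zero norm counts as \<open>0 / 0 = 0\<close>.\<close>

fun relloss :: "('l \<Rightarrow> real) \<Rightarrow> 'l set \<Rightarrow> 'l list \<Rightarrow> real" where
  "relloss a S [] = 0"
| "relloss a S (l # ls) = (a l)\<^sup>2 / sqsum a S + relloss a (S - {l}) ls"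

section \<open>Squared norms under successive deletions\<close>

lemma sqsum_nonneg: "0 \<le> sqsum a S"
  by (simp add: sqsum_def sum_nonneg)

lemma sqsum_remove: "finite S \<Longrightarrow> l \<in> S \<Longrightarrow> sqsum a S = (a l)\<^sup>2 + sqsum a (S - {l})"
  by (simp add: sqsum_def sum.remove)

lemma sq_le_sqsum: "finite S \<Longrightarrow> l \<in> S \<Longrightarrow> (a l)\<^sup>2 \<le> sqsum a S"
  using sqsum_remove[of S l a] sqsum_nonneg[of a "S - {l}"] by simp

lemma relative_loss_bounds:
  assumes "finite S" "l \<in> S"
  shows "0 \<le> (a l)\<^sup>2 / sqsum a S" "(a l)\<^sup>2 / sqsum a S \<le> 1"
proof -
  show "0 \<le> (a l)\<^sup>2 / sqsum a S" using sqsum_nonneg[of a S] by simp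
  show "(a l)\<^sup>2 / sqsum a S \<le> 1"
    using sq_le_sqsum[OF assms, of a] sqsum_nonneg[of a S]
    by (cases "sqsum a S = 0") (auto simp: field_simps)
qed

lemma relloss_append:
  "relloss a S (ls @ ls') = relloss a S ls + relloss a (S - set ls) ls'"
proof (induction ls arbitrary: S)
  case (Cons l ls)
  have "S - {l} - set ls = S - set (l # ls)" by auto
  with Cons show ?case by simp
qed simp

text \<open>A deletion of relative loss x multiplies the squared norm by 1 - x \<le> exp (- x), and
  these factors accumulate.\<close>

lemma sqsum_le_exp_relloss:
  assumes "finite S" "distinct ls" "set ls \<subseteq> S"
  shows "sqsum a (S - set ls) \<le> exp (- relloss a S ls) * sqsum a S"
  using assms
proof (induction ls arbitrary: S)
  case (Cons l ls)
  define x where "x = (a l)\<^sup>2 / sqsum a S"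
  have l: "l \<in> S" using Cons by auto
  have eq: "S - {l} - set ls = S - set (l # ls)" by auto
  have 1: "sqsum a (S - {l}) = (1 - x) * sqsum a S"
  proof (cases "sqsum a S = 0")
    case True
    then have "sqsum a (S - {l}) = 0"
      using sqsum_remove[OF Cons.prems(1) l, of a] sqsum_nonneg[of a "S - {l}"] by (smt (verit) zero_le_power2)
    with True show ?thesis by simp
  next
    case False
    then show ?thesis
      using sqsum_remove[OF Cons.prems(1) l, of a] by (simp add: x_def field_simps)
  qed
  have "sqsum a (S - {l} - set ls) \<le> exp (- relloss a (S - {l}) ls) * sqsum a (S - {l})"
    using Cons.prems by (intro Cons.IH) auto
  also have "\<dots> \<le> exp (- relloss a (S - {l}) ls) * (exp (- x) * sqsum a S)"
    unfolding 1 using exp_ge_add_one_self[of "-x"] sqsum_nonneg[of a S]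
    by (intro mult_left_mono mult_right_mono) auto
  also have "\<dots> = exp (- relloss a S (l # ls)) * sqsum a S"
    by (simp add: exp_add[symmetric] exp_minus_inverse x_def mult.assoc[symmetric] add.commute)
  finally show ?case by (simp only: eq)
qed simp

text \<open>A single deletion loses at most 1, so the shortest prefix that reaches
  \<open>\<beta>\<close> overshoots by at most 1.\<close>

lemma relloss_split:
  assumes "finite S" "distinct ls" "set ls \<subseteq> S" "0 \<le> \<beta>" "\<beta> \<le> relloss a S ls"
  obtains ls1 ls2 where "ls = ls1 @ ls2" "\<beta> \<le> relloss a S ls1" "relloss a S ls1 \<le> \<beta> + 1"
proof -
  have "\<exists>ls1 ls2. ls = ls1 @ ls2 \<and> \<beta> \<le> relloss a S ls1 \<and> relloss a S ls1 \<le> \<beta> + 1"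
    using assms(2,3,5)
  proof (induction ls rule: rev_induct)
    case Nil
    with assms(4) show ?case by auto
  next
    case (snoc l ls)
    show ?case
    proof (cases "\<beta> \<le> relloss a S ls")
      case True
      then obtain ls1 ls2 where "ls = ls1 @ ls2 \<and> \<beta> \<le> relloss a S ls1 \<and> relloss a S ls1 \<le> \<beta> + 1"
        using snoc by auto
      then show ?thesis by (metis append.assoc)
    next
      case False
      have "relloss a S (ls @ [l]) = relloss a S ls + (a l)\<^sup>2 / sqsum a (S - set ls)"
        by (simp add: relloss_append)
      also have "(a l)\<^sup>2 / sqsum a (S - set ls) \<le> 1"
        using snoc.prems assms(1) by (intro relative_loss_bounds) auto
      finally have "relloss a S (ls @ [l]) \<le> \<beta> + 1" using False by linarith
      then show ?thesis using snoc.prems by (metis append_Nil2)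
    qed
  qed
  then show thesis using that by blast
qed

lemma sum_abs_square_le:
  fixes a :: "'l \<Rightarrow> real"
  assumes "finite S"
  shows "(\<Sum>l\<in>S. \<bar>a l\<bar>)\<^sup>2 \<le> card S * sqsum a S"
proof -
  have "(\<Sum>l\<in>S. \<bar>a l\<bar>)\<^sup>2 = (\<Sum>l\<in>S. \<Sum>m\<in>S. \<bar>a l\<bar> * \<bar>a m\<bar>)"
    by (simp add: power2_eq_square sum_product)
  also have "\<dots> \<le> (\<Sum>l\<in>S. \<Sum>m\<in>S. ((a l)\<^sup>2 + (a m)\<^sup>2) / 2)"
  proof (intro sum_mono)
    fix l m
    have "0 \<le> (\<bar>a l\<bar> - \<bar>a m\<bar>)\<^sup>2" by simp
    then show "\<bar>a l\<bar> * \<bar>a m\<bar> \<le> ((a l)\<^sup>2 + (a m)\<^sup>2) / 2" by (simp add: power2_diff)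
  qed
  also have "\<dots> = card S * sqsum a S"
    by (simp add: sqsum_def sum.distrib add_divide_distrib sum_divide_distrib[symmetric] sum_distrib_left[symmetric])
  finally show ?thesis .
qed

lemma sum_sg_Un:
  assumes "finite A" "finite B" "A \<inter> B = {}" "X \<subseteq> A" "Y \<subseteq> B"
  shows "(\<Sum>l\<in>A \<union> B. a l * sg (X \<union> Y) l) = (\<Sum>l\<in>A. a l * sg X l) + (\<Sum>l\<in>B. a l * sg Y l)"
proof -
  have "(\<Sum>l\<in>A. a l * sg (X \<union> Y) l) = (\<Sum>l\<in>A. a l * sg X l)"
    "(\<Sum>l\<in>B. a l * sg (X \<union> Y) l) = (\<Sum>l\<in>B. a l * sg Y l)"
    using assms by (auto intro!: sum.cong simp: sg_def)
  then show ?thesis using assms by (simp add: sum.union_disjoint)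
qed

lemma abs_sum_sg_le: "\<bar>\<Sum>l\<in>A. a l * sg X l\<bar> \<le> (\<Sum>l\<in>A. \<bar>a l\<bar>)"
  by (rule order.trans[OF sum_abs]) (auto intro!: sum_mono simp: sg_def)

text \<open>Whenever the relative losses add up to \<open>2 ln n + 1\<close>, the squared norm has dropped by a factor
  above \<open>n\<^sup>2\<close>, so one of the deleted coefficients exceeds the sum of all remaining ones and its sign
  halves the probability of being close to \<open>b\<close>.\<close>

lemma window_prob_le:
  assumes "finite S" "card S \<le> n" "n \<ge> 1" "distinct ls" "set ls \<subseteq> S"
    and "real T * (2 * ln n + 2) \<le> relloss a S ls"
  shows "pexp (\<lambda>_. 0) (set ls)
    (\<lambda>X. of_bool (\<bar>(\<Sum>l\<in>set ls. a l * sg X l) - b\<bar> \<le> (\<Sum>l\<in>S - set ls. \<bar>a l\<bar>))) \<le> 1 / 2 ^ T"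
  using assms
proof (induction T arbitrary: S ls b)
  case 0
  then show ?case by (auto intro!: pexp_le_const)
next
  case (Suc T)
  \<comment> \<open>Splitting off a prefix of loss at least \<open>\<beta>\<close> may cost up to
    \<open>\<beta> + 1\<close>, which is the budget \<open>2 * ln n + 2\<close> for one halving of
    the probability.\<close>
  define \<beta> where "\<beta> = 2 * ln (real n) + 1"
  have ln0: "0 \<le> ln (real n)" using Suc.prems(3) by simp
  have \<beta>0: "0 \<le> \<beta>" using ln0 by (simp add: \<beta>_def)
  have "\<beta> \<le> 1 * (2 * ln n + 2)" by (simp add: \<beta>_def)
  also have "\<dots> \<le> real (Suc T) * (2 * ln n + 2)" using ln0 by (intro mult_right_mono) auto
  also have "\<dots> \<le> relloss a S ls" by (rule Suc.prems(6))
  finally have \<beta>_le: "\<beta> \<le> relloss a S ls" .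
  obtain ls1 ls2 where ls: "ls = ls1 @ ls2" and l1: "\<beta> \<le> relloss a S ls1" "relloss a S ls1 \<le> \<beta> + 1"
    by (rule relloss_split[OF Suc.prems(1,4,5) \<beta>0 \<beta>_le])
  define S1 where "S1 = S - set ls1"
  define N0 N1 where "N0 = sqsum a S" and "N1 = sqsum a S1"
  have fin: "finite S1" and sub: "set ls1 \<subseteq> S" "set ls2 \<subseteq> S1" and dist: "distinct ls1" "distinct ls2"
    and disj: "set ls1 \<inter> set ls2 = {}"
    using Suc.prems ls by (auto simp: S1_def)
  have cS1: "card S1 \<le> n" using Suc.prems(1,2) card_mono[of S S1] by (force simp: S1_def)
  have n1: "(real n)\<^sup>2 \<ge> 1" using Suc.prems(3) by simp
  have N01: "N0 = sqsum a (set ls1) + N1"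
    using sub(1) Suc.prems(1) unfolding N0_def N1_def S1_def sqsum_def
    by (metis add.commute sum.subset_diff)
  have eb: "exp (- \<beta>) * N0 \<ge> N1"
  proof -
    have "N1 \<le> exp (- relloss a S ls1) * N0"
      unfolding N0_def N1_def S1_def using Suc.prems(1) dist sub by (intro sqsum_le_exp_relloss)
    also have "\<dots> \<le> exp (- \<beta>) * N0"
      using l1 sqsum_nonneg[of a S] by (intro mult_right_mono) (auto simp: N0_def)
    finally show ?thesis .
  qed
  \<comment> \<open>With a zero norm every relative loss would be 0 / 0 = 0, but the prefix
    \<open>ls1\<close> has loss at least \<open>\<beta> > 0\<close>.\<close>
  have N0pos: "N0 > 0"
  proof (rule ccontr)
    assume "\<not> N0 > 0"
    then have z: "N0 = 0" using sqsum_nonneg[of a S] by (simp add: N0_def)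
    have "relloss a S' ks = 0" if "S' \<subseteq> S" for S' ks
      using that
    proof (induction ks arbitrary: S')
      case (Cons k ks)
      have "sqsum a S' \<le> sqsum a S"
        unfolding sqsum_def using Cons.prems Suc.prems(1) by (intro sum_mono2) auto
      then have "sqsum a S' = 0" using z sqsum_nonneg[of a S'] by (simp add: N0_def)
      moreover have "relloss a (S' - {k}) ks = 0" using Cons by blast
      ultimately show ?case by simp
    qed simp
    from this[of S ls1] l1 ln0 show False by (simp add: \<beta>_def)
  qed
  have big: "(n\<^sup>2 + 1) * N1 < N0"
  proof -
    have e: "exp \<beta> = exp 1 * (real n)\<^sup>2"
      using Suc.prems(3) by (simp add: \<beta>_def exp_add exp_double)
    have "exp \<beta> * N1 \<le> N0"
      using mult_left_mono[OF eb, of "exp \<beta>"] by (simp add: mult.assoc[symmetric] exp_minus_inverse)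
    moreover have "(n\<^sup>2 + 1) < exp \<beta>"
    proof -
      have "(2::real) < exp 1" using exp_ge_add_one_self[of "1::real"] exp_gt_one[of "1::real"] e_less_272 
        by (smt (verit) exp_less_mono ln_2_less_1 exp_ln)
      then have "2 * (real n)\<^sup>2 < exp 1 * (real n)\<^sup>2" using Suc.prems(3) by (intro mult_strict_right_mono) auto
      moreover have "real (n\<^sup>2 + 1) \<le> 2 * (real n)\<^sup>2" using n1 by simp
      ultimately show ?thesis unfolding e by linarith
    qed
    moreover have "0 \<le> N1" using sqsum_nonneg[of a S1] by (simp add: N1_def)
    ultimately show ?thesis
      using N0pos mult_strict_right_mono[of "real (n\<^sup>2 + 1)" "exp \<beta>" N1]
      by (cases "N1 = 0") (simp, linarith)
  qed
  \<comment> \<open>Otherwise each of the at most \<open>n\<close> deleted squares is at most the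
    square of the remaining absolute sum, which is at most \<open>n * N1\<close> by Cauchy-Schwarz;
    then \<open>N0\<close> is at most \<open>(n\<^sup>2 + 1) * N1\<close>, against
    \<open>big\<close>.\<close>
  obtain m where m: "m \<in> set ls1" "(\<Sum>l\<in>S1. \<bar>a l\<bar>) < \<bar>a m\<bar>"
  proof (rule ccontr)
    assume "\<not> thesis"
    then have le: "\<bar>a m\<bar> \<le> (\<Sum>l\<in>S1. \<bar>a l\<bar>)" if "m \<in> set ls1" for m
      using that \<open>\<And>m. \<lbrakk>m \<in> set ls1; (\<Sum>l\<in>S1. \<bar>a l\<bar>) < \<bar>a m\<bar>\<rbrakk> \<Longrightarrow> thesis\<close> by fastforce
    have "sqsum a (set ls1) \<le> (\<Sum>m\<in>set ls1. (\<Sum>l\<in>S1. \<bar>a l\<bar>)\<^sup>2)"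
      unfolding sqsum_def using le by (intro sum_mono) (metis abs_ge_zero power2_abs power_mono)
    also have "\<dots> \<le> n * (n * N1)"
    proof -
      have "card (set ls1) \<le> n" using card_mono[OF Suc.prems(1) sub(1)] Suc.prems(2) by simp
      moreover have "(\<Sum>l\<in>S1. \<bar>a l\<bar>)\<^sup>2 \<le> n * N1"
        using sum_abs_square_le[OF fin, of a] cS1 sqsum_nonneg[of a S1] unfolding N1_def
        by (smt (verit) mult_right_mono of_nat_mono)
      ultimately show ?thesis
        by (simp only: sum_constant) (intro mult_mono, auto)
    qed
    finally show False using big N01 by (simp add: power2_eq_square algebra_simps)
  qed
  define D where "D = set ls1 - {m}"
  have D: "finite D" "m \<notin> D" "set ls1 = insert m D" using m by (auto simp: D_def)
  define R where "R = (\<Sum>l\<in>S1 - set ls2. \<bar>a l\<bar>)"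
  have S2: "S - set ls = S1 - set ls2" by (auto simp: S1_def ls)
  have Rsum: "(\<Sum>l\<in>S1. \<bar>a l\<bar>) = (\<Sum>l\<in>set ls2. \<bar>a l\<bar>) + R"
    unfolding R_def by (metis add.commute sub(2) fin sum.subset_diff)
  define F where "F X = (of_bool (\<bar>(\<Sum>l\<in>set ls1 \<union> set ls2. a l * sg X l) - b\<bar> \<le> R) :: real)" for X
  have relloss2: "real T * (2 * ln n + 2) \<le> relloss a S1 ls2"
    using Suc.prems(6) l1(2) unfolding ls relloss_append S1_def[symmetric] \<beta>_def by (simp add: algebra_simps)
  have IH: "pexp (\<lambda>_. 0) (set ls2) (\<lambda>Y. F (X \<union> Y)) \<le> 1 / 2 ^ T" if "X \<subseteq> set ls1" for X
  proof -
    have "pexp (\<lambda>_. 0) (set ls2) (\<lambda>Y. F (X \<union> Y)) =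
        pexp (\<lambda>_. 0) (set ls2) (\<lambda>Y. of_bool (\<bar>(\<Sum>l\<in>set ls2. a l * sg Y l) - (b - (\<Sum>l\<in>set ls1. a l * sg X l))\<bar> \<le> R))"
      using that disj unfolding F_def by (intro pexp_cong) (simp add: sum_sg_Un algebra_simps)
    also have "\<dots> \<le> 1 / 2 ^ T"
      unfolding R_def using fin cS1 Suc.prems(3) dist(2) sub(2) relloss2 by (intro Suc.IH)
    finally show ?thesis .
  qed
  have zero: "pexp (\<lambda>_. 0) (set ls2) (\<lambda>Y. F (X \<union> Y)) = 0"
    if "X \<subseteq> set ls1" "\<bar>(\<Sum>l\<in>set ls1. a l * sg X l) - b\<bar> > (\<Sum>l\<in>S1. \<bar>a l\<bar>)" for X
  proof -
    have "F (X \<union> Y) = 0" if Y: "Y \<subseteq> set ls2" for Y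
    proof -
      have "(\<Sum>l\<in>set ls1 \<union> set ls2. a l * sg (X \<union> Y) l) = (\<Sum>l\<in>set ls1. a l * sg X l) + (\<Sum>l\<in>set ls2. a l * sg Y l)"
        using that Y disj \<open>X \<subseteq> set ls1\<close> by (intro sum_sg_Un) auto
      then show ?thesis
        using \<open>\<bar>(\<Sum>l\<in>set ls1. a l * sg X l) - b\<bar> > (\<Sum>l\<in>S1. \<bar>a l\<bar>)\<close> abs_sum_sg_le[of a Y "set ls2"] Rsum
        by (auto simp: F_def)
    qed
    then have "pexp (\<lambda>_. 0) (set ls2) (\<lambda>Y. F (X \<union> Y)) = pexp (\<lambda>_. 0) (set ls2) (\<lambda>_. 0)"
      by (intro pexp_cong)
    then show ?thesis by (simp add: pexp_const)
  qed
  \<comment> \<open>For fixed other signs, the two choices for \<open>m\<close> give values 2 *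
    \<bar>a m\<bar> apart. At least one of them is too far from \<open>b\<close> for the remaining
    coordinates to repair, so only the other can contribute.\<close>
  have half: "1 / 2 * pexp (\<lambda>_. 0) (set ls2) (\<lambda>Y. F (insert m X \<union> Y)) +
      1 / 2 * pexp (\<lambda>_. 0) (set ls2) (\<lambda>Y. F (X \<union> Y)) \<le> 1 / 2 ^ Suc T" if X: "X \<subseteq> D" for X
  proof -
    let ?r = "\<Sum>l\<in>D. a l * sg X l"
    have mX: "m \<notin> X" using X D by auto
    have s1: "(\<Sum>l\<in>set ls1. a l * sg (insert m X) l) = ?r + a m"
      unfolding D(3) using D sum_sg_insert[OF D(1,2), of "\<lambda>l s. a l * s" X] by (simp add: sg_def)
    have s2: "(\<Sum>l\<in>set ls1. a l * sg X l) = ?r - a m"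
      unfolding D(3) using D mX by (simp add: sg_def)
    have sub': "insert m X \<subseteq> set ls1" "X \<subseteq> set ls1" using X D by auto
    have "\<bar>(?r + a m) - b\<bar> > (\<Sum>l\<in>S1. \<bar>a l\<bar>) \<or> \<bar>(?r - a m) - b\<bar> > (\<Sum>l\<in>S1. \<bar>a l\<bar>)"
      using m(2) by linarith
    then show ?thesis
    proof
      assume "\<bar>(?r + a m) - b\<bar> > (\<Sum>l\<in>S1. \<bar>a l\<bar>)"
      then have "pexp (\<lambda>_. 0) (set ls2) (\<lambda>Y. F (insert m X \<union> Y)) = 0"
        using zero[OF sub'(1)] s1 by simp
      with IH[OF sub'(2)] show ?thesis by simp
    next
      assume "\<bar>(?r - a m) - b\<bar> > (\<Sum>l\<in>S1. \<bar>a l\<bar>)"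
      then have "pexp (\<lambda>_. 0) (set ls2) (\<lambda>Y. F (X \<union> Y)) = 0"
        using zero[OF sub'(2)] s2 by simp
      with IH[OF sub'(1)] show ?thesis by simp
    qed
  qed
  have "pexp (\<lambda>_. 0) (set ls) (\<lambda>X. of_bool (\<bar>(\<Sum>l\<in>set ls. a l * sg X l) - b\<bar> \<le> (\<Sum>l\<in>S - set ls. \<bar>a l\<bar>)))
      = pexp (\<lambda>_. 0) (set ls1 \<union> set ls2) F"
    unfolding S2 R_def[symmetric] F_def by (simp add: ls)
  also have "\<dots> = pexp (\<lambda>_. 0) (set ls1) (\<lambda>X. pexp (\<lambda>_. 0) (set ls2) (\<lambda>Y. F (X \<union> Y)))"
    using disj by (intro pexp_Un) auto
  also have "\<dots> = pexp (\<lambda>_. 0) D (\<lambda>X. 1 / 2 * pexp (\<lambda>_. 0) (set ls2) (\<lambda>Y. F (insert m X \<union> Y)) +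
      1 / 2 * pexp (\<lambda>_. 0) (set ls2) (\<lambda>Y. F (X \<union> Y)))"
    unfolding D(3) pexp_insert[OF D(1,2)] pexp_add pexp_cmult by simp
  also have "\<dots> \<le> 1 / 2 ^ Suc T"
    using half D(1) by (intro pexp_le_const) auto
  finally show ?case .
qed

text \<open>Take a longest list of deletions whose total loss, truncated at \<open>L + 1\<close> in
  each row, is at least \<open>\<kappa>\<close> per deletion. The truncation limits its length to
  \<open>n / 2\<close>. Maximality gives the column bound for the rows \<open>J\<close> of loss
  below \<open>L\<close>. Rows of loss at least \<open>L\<close> are handled by
  \<open>window_prob_le\<close> and a union bound over \<open>I\<close>, which yields the signs
  \<open>X\<close>.\<close>

lemma remove_dominant_coordinates:
  fixes a :: "'i \<Rightarrow> nat \<Rightarrow> real"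
  assumes I: "finite I" "card I < 2 ^ T" and n: "n \<ge> 1"
    and \<kappa>: "\<kappa> > 0" "\<kappa> * real n \<ge> 2 * card I * (real T * (2 * ln n + 2) + 1)"
  obtains D X J where "D \<subseteq> {..<n}" "2 * card D \<le> n" "X \<subseteq> D" "J \<subseteq> I"
    "\<And>i. i \<in> J \<Longrightarrow> sqsum (a i) ({..<n} - D) > 0"
    "\<And>l. l \<in> {..<n} - D \<Longrightarrow> (\<Sum>i\<in>J. (a i l)\<^sup>2 / sqsum (a i) ({..<n} - D)) \<le> \<kappa>"
    "\<And>i. i \<in> I - J \<Longrightarrow> (\<forall>l\<in>{..<n} - D. a i l = 0) \<or>
       \<bar>(\<Sum>l\<in>D. a i l * sg X l) - b i\<bar> > (\<Sum>l\<in>{..<n} - D. \<bar>a i l\<bar>)"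
proof -
  define U where "U = {..<n}"
  define L where "L = real T * (2 * ln n + 2)"
  define good where "good ls \<longleftrightarrow> distinct ls \<and> set ls \<subseteq> U \<and>
    \<kappa> * length ls \<le> (\<Sum>i\<in>I. min (relloss (a i) U ls) (L + 1))" for ls
  have L0: "L \<ge> 0" using n by (simp add: L_def)
  have "good []" using L0 by (simp add: good_def sum_nonneg)
  moreover have "\<forall>ls. good ls \<longrightarrow> length ls < Suc n"
    unfolding good_def U_def by (metis card_lessThan card_mono distinct_card finite_lessThan le_imp_less_Suc)
  ultimately obtain ls where ls: "good ls" "\<And>ls'. good ls' \<Longrightarrow> length ls' \<le> length ls"
    using ex_has_greatest_nat[of good "[]" length] by metis
  define D S where "D = set ls" and "S = U - D"
  have lsD: "distinct ls" "D \<subseteq> U" "\<kappa> * card D \<le> (\<Sum>i\<in>I. min (relloss (a i) U ls) (L + 1))"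
    using ls(1) by (auto simp: good_def D_def distinct_card)
  define J where "J = {i \<in> I. relloss (a i) U ls < L \<and> sqsum (a i) S > 0}"
  have finU: "finite U" "finite S" "finite D" by (auto simp: U_def S_def D_def)
  have card_D: "2 * card D \<le> n"
  proof -
    have "\<kappa> * card D \<le> (\<Sum>i\<in>I. L + 1)"
      using lsD(3) by (rule order.trans) (intro sum_mono, simp)
    then have "2 * (\<kappa> * card D) \<le> \<kappa> * n" using \<kappa>(2) by (simp add: L_def)
    then have "\<kappa> * (2 * card D) \<le> \<kappa> * n" by simp
    then have "real (2 * card D) \<le> real n" using \<kappa>(1) by (subst (asm) mult_le_cancel_left_pos) auto
    then show ?thesis by linarith
  qed
  have columns: "(\<Sum>i\<in>J. (a i l)\<^sup>2 / sqsum (a i) S) \<le> \<kappa>" if l: "l \<in> S" for l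
  proof (rule ccontr)
    assume "\<not> ?thesis"
    then have gt: "\<kappa> < (\<Sum>i\<in>J. (a i l)\<^sup>2 / sqsum (a i) S)" by simp
    have snoc: "relloss (a i) U (ls @ [l]) = relloss (a i) U ls + (a i l)\<^sup>2 / sqsum (a i) S" for i
      by (simp add: relloss_append S_def D_def)
    have "\<kappa> * length (ls @ [l]) \<le> (\<Sum>i\<in>I. min (relloss (a i) U ls) (L + 1)) + (\<Sum>i\<in>J. (a i l)\<^sup>2 / sqsum (a i) S)"
      using gt ls(1) by (simp add: good_def algebra_simps)
    also have "(\<Sum>i\<in>J. (a i l)\<^sup>2 / sqsum (a i) S) = (\<Sum>i\<in>I. if i \<in> J then (a i l)\<^sup>2 / sqsum (a i) S else 0)"
      using I(1) by (subst sum.inter_filter[symmetric]) (auto simp: J_def intro!: sum.cong)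
    \<comment> \<open>A row in \<open>J\<close> has lost less than \<open>L\<close> and loses at
      most 1 more, so truncation at \<open>L + 1\<close> hides none of its gain and the longer list
      is still good.\<close>
    also have "(\<Sum>i\<in>I. min (relloss (a i) U ls) (L + 1)) + \<dots> \<le> (\<Sum>i\<in>I. min (relloss (a i) U (ls @ [l])) (L + 1))"
      unfolding sum.distrib[symmetric] snoc
    proof (intro sum_mono)
      fix i assume "i \<in> I"
      show "min (relloss (a i) U ls) (L + 1) + (if i \<in> J then (a i l)\<^sup>2 / sqsum (a i) S else 0)
        \<le> min (relloss (a i) U ls + (a i l)\<^sup>2 / sqsum (a i) S) (L + 1)"
        using relative_loss_bounds[OF finU(2) l, of "a i"] by (auto simp: J_def min_def)
    qed
    finally have "good (ls @ [l])"
      using lsD(1,2) l by (auto simp: good_def S_def D_def)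
    from ls(2)[OF this] show False by simp
  qed
  define dead where "dead = {i \<in> I. relloss (a i) U ls \<ge> L}"
  define W where "W i X = (of_bool (\<bar>(\<Sum>l\<in>D. a i l * sg X l) - b i\<bar> \<le> (\<Sum>l\<in>S. \<bar>a i l\<bar>)) :: real)" for i X
  have "pexp (\<lambda>_. 0) D (W i) \<le> 1 / 2 ^ T" if "i \<in> dead" for i
    using window_prob_le[of U n ls T "a i" "b i"] that n lsD(1,2) finU
    by (simp add: dead_def L_def D_def S_def U_def W_def[abs_def])
  then have "(\<Sum>i\<in>dead. pexp (\<lambda>_. 0) D (W i)) \<le> (\<Sum>i\<in>dead. 1 / 2 ^ T)"
    by (rule sum_mono)
  also have "\<dots> \<le> card I / 2 ^ T"
    using card_mono[OF I(1), of dead] by (auto simp: dead_def divide_right_mono)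
  also have "\<dots> < 1" using I(2) by simp
  finally have "pexp (\<lambda>_. 0) D (\<lambda>X. \<Sum>i\<in>dead. W i X) < 1" by (simp add: pexp_sum)
  moreover obtain X where "X \<subseteq> D" "(\<Sum>i\<in>dead. W i X) \<le> pexp (\<lambda>_. 0) D (\<lambda>X. \<Sum>i\<in>dead. W i X)"
    by (rule pexp_exists_le[of D "\<lambda>_. 0" "\<lambda>X. \<Sum>i\<in>dead. W i X"]) (use finU in auto)
  ultimately have X: "X \<subseteq> D" "(\<Sum>i\<in>dead. W i X) < 1" by auto
  have dead: "\<bar>(\<Sum>l\<in>D. a i l * sg X l) - b i\<bar> > (\<Sum>l\<in>S. \<bar>a i l\<bar>)" if i: "i \<in> dead" for i
  proof (rule ccontr)
    assume "\<not> ?thesis"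
    then have "W i X = 1" by (simp add: W_def)
    moreover have "W i X \<le> (\<Sum>i\<in>dead. W i X)"
      using i I(1) by (intro member_le_sum) (auto simp: W_def dead_def)
    ultimately show False using X(2) by simp
  qed
  show thesis
  proof (rule that[of D X J])
    show "D \<subseteq> {..<n}" using lsD(2) by (simp add: U_def)
    fix i assume i: "i \<in> I - J"
    show "(\<forall>l\<in>{..<n} - D. a i l = 0) \<or> \<bar>(\<Sum>l\<in>D. a i l * sg X l) - b i\<bar> > (\<Sum>l\<in>{..<n} - D. \<bar>a i l\<bar>)"
    proof (cases "i \<in> dead")
      case True
      then show ?thesis using dead by (simp add: S_def U_def)
    next
      case False
      then have "sqsum (a i) S = 0" using i sqsum_nonneg[of "a i" S] by (auto simp: J_def dead_def)
      then have "\<forall>l\<in>S. a i l = 0" using finU by (simp add: sqsum_def sum_nonneg_eq_0_iff)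
      then show ?thesis by (simp add: S_def U_def)
    qed
  qed (use card_D X columns in \<open>auto simp: J_def S_def U_def\<close>)
qed


section \<open>A random walk that avoids slabs\<close>

definition clip :: "real \<Rightarrow> real \<Rightarrow> real" where
  "clip u x = max (- u) (min u x)"

text \<open>Equal to x^2 / 2 on [-u, u] and continued linearly with slopes u and -u;
  \<open>clip u\<close> is its derivative. As a potential it is quadratic inside a slab and grows
  only linearly outside.\<close>

definition huber :: "real \<Rightarrow> real \<Rightarrow> real" where
  "huber u x = clip u x * x - (clip u x)\<^sup>2 / 2"

text \<open>The Huber function is the maximum of the lines on the left, attained at
  \<open>s = clip u x\<close>. This gives its tangent and Lipschitz inequalities.\<close>

lemma huber_ge:
  assumes "\<bar>s\<bar> \<le> u"
  shows "s * x - s\<^sup>2 / 2 \<le> huber u x"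
proof -
  have "2 * (huber u x - (s * x - s\<^sup>2 / 2)) = (clip u x - s) * (2 * x - clip u x - s)"
    by (simp add: huber_def algebra_simps power2_eq_square)
  also have "\<dots> \<ge> 0"
  proof (cases "clip u x \<ge> s")
    case True
    then show ?thesis using assms
      by (cases "clip u x = s") (auto simp: clip_def max_def min_def split: if_splits intro!: mult_nonneg_nonneg)
  next
    case False
    then show ?thesis using assms
      by (auto simp: clip_def max_def min_def split: if_splits intro!: mult_nonpos_nonpos)
  qed
  finally show ?thesis by simp
qed

lemma abs_clip_le: "u \<ge> 0 \<Longrightarrow> \<bar>clip u x\<bar> \<le> u"
  by (auto simp: clip_def)

lemma huber_tangent:
  assumes "u \<ge> 0"
  shows "huber u x + clip u x * d \<le> huber u (x + d)"
  using huber_ge[OF abs_clip_le[OF assms, of x], of "x + d"] by (simp add: huber_def algebra_simps)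

lemma huber_quadratic:
  assumes "\<bar>x\<bar> \<le> u"
  shows "huber u x = x\<^sup>2 / 2" "clip u x = x"
  using assms by (auto simp: huber_def clip_def power2_eq_square)

lemma huber_lipschitz:
  assumes "u \<ge> 0"
  shows "huber u y - huber u x \<le> u * \<bar>y - x\<bar>"
proof -
  have "huber u y - huber u x \<le> clip u y * (y - x)"
    using huber_tangent[OF assms, of y "x - y"] by (simp add: algebra_simps)
  also have "\<dots> \<le> \<bar>clip u y\<bar> * \<bar>y - x\<bar>" by (metis abs_ge_self abs_mult)
  also have "\<dots> \<le> u * \<bar>y - x\<bar>" using abs_clip_le[OF assms] by (intro mult_right_mono) auto
  finally show ?thesis .
qed

section \<open>The walk and its parameters\<close>

text \<open>The slabs have half-width \<open>w\<close>, a boost raises the variance from 1 to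
  \<open>1 + Z\<close>, a step takes time \<open>h\<^sup>2\<close>, and \<open>T\<close> is the time
  horizon. The conditions on \<open>h\<close> ensure that one step moves no inner product by more
  than \<open>w\<close> and that one boosted step adds variance at most \<open>T\<close>.\<close>

locale slab_walk =
  fixes A :: "'i set" and S :: "'l set" and v :: "'i \<Rightarrow> 'l \<Rightarrow> real" and b :: "'i \<Rightarrow> real"
    and w Z T h :: real
  assumes fin: "finite A" "finite S"
    and unit: "\<And>i. i \<in> A \<Longrightarrow> (\<Sum>l\<in>S. (v i l)\<^sup>2) = 1"
    and pos: "w > 0" "Z > 0" "T > 0" "h > 0"
    and h_small: "h * card A * sqrt (1 + Z) \<le> w" "h\<^sup>2 * (1 + Z) \<le> T"
begin

definition "ip i p = (\<Sum>l\<in>S. v i l * p l)"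
definition "gram i j = (\<Sum>l\<in>S. v i l * v j l)"
definition "corr i = (\<Sum>j\<in>A. (gram i j)\<^sup>2)"
definition "near i p \<longleftrightarrow> \<bar>ip i p - b i\<bar> \<le> w"
text \<open>The factor on the variance of the step along \<open>v j\<close>, whence the square root
  in \<open>step\<close>. Strongly correlated directions are left alone: there the walk already has
  variance at least \<open>corr j\<close> across the hyperplane.\<close>

definition "boost j p = (if near j p \<and> 48 * w\<^sup>2 * corr j \<le> T then 1 + Z else 1)"
definition "step p X = (\<lambda>l. p l + (\<Sum>j\<in>A. h * sqrt (boost j p) * v j l * sg X j))"
text \<open>The transition operator of the walk: \<open>(avg ^^ m) f p\<close> is the expectation of
  \<open>f\<close> after \<open>m\<close> steps from \<open>p\<close>.\<close>

definition "avg f p = pexp (\<lambda>_. 0) A (\<lambda>X. f (step p X))"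
definition "qvar i p = (\<Sum>j\<in>A. (gram i j)\<^sup>2 * boost j p)"
definition "cvar l p = (\<Sum>j\<in>A. (v j l)\<^sup>2 * boost j p)"

text \<open>The expected sum of \<open>f\<close> over the first \<open>m\<close> positions of the
  walk, the starting point included.\<close>

fun acc :: "(('l \<Rightarrow> real) \<Rightarrow> real) \<Rightarrow> nat \<Rightarrow> ('l \<Rightarrow> real) \<Rightarrow> real" where
  "acc f 0 p = 0"
| "acc f (Suc m) p = f p + avg (acc f m) p"

lemma boost_bounds: "1 \<le> boost j p" "boost j p \<le> 1 + Z"
  using pos by (auto simp: boost_def)

lemma boost_nonneg: "0 \<le> boost j p"
  using boost_bounds(1)[of j p] by simp

lemma gram_self: "i \<in> A \<Longrightarrow> gram i i = 1"
  using unit by (simp add: gram_def power2_eq_square)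

lemma gram_le: 
  assumes "i \<in> A" "j \<in> A"
  shows "\<bar>gram i j\<bar> \<le> 1"
proof -
  have "\<bar>gram i j\<bar> \<le> (\<Sum>l\<in>S. \<bar>v i l * v j l\<bar>)" unfolding gram_def by (rule sum_abs)
  also have "\<dots> \<le> (\<Sum>l\<in>S. ((v i l)\<^sup>2 + (v j l)\<^sup>2) / 2)"
  proof (intro sum_mono)
    fix l
    have "0 \<le> (\<bar>v i l\<bar> - \<bar>v j l\<bar>)\<^sup>2" by simp
    then show "\<bar>v i l * v j l\<bar> \<le> ((v i l)\<^sup>2 + (v j l)\<^sup>2) / 2" by (simp add: power2_diff abs_mult)
  qed
  also have "\<dots> = 1"
    using unit assms by (simp add: sum_divide_distrib[symmetric] sum.distrib)
  finally show ?thesis .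
qed

lemma ip_step: "ip i (step p X) = ip i p + (\<Sum>j\<in>A. h * sqrt (boost j p) * gram i j * sg X j)"
proof -
  have "(\<Sum>l\<in>S. v i l * (\<Sum>j\<in>A. h * sqrt (boost j p) * v j l * sg X j)) =
      (\<Sum>j\<in>A. \<Sum>l\<in>S. v i l * (h * sqrt (boost j p) * v j l * sg X j))"
    by (subst sum.swap) (simp add: sum_distrib_left)
  also have "\<dots> = (\<Sum>j\<in>A. h * sqrt (boost j p) * gram i j * sg X j)"
    by (simp add: gram_def sum_distrib_left sum_distrib_right mult_ac)
  finally show ?thesis
    by (simp add: ip_def step_def distrib_left sum.distrib)
qed

lemma ip_step_small:
  assumes "i \<in> A"
  shows "\<bar>ip i (step p X) - ip i p\<bar> \<le> w"
proof -
  have "\<bar>ip i (step p X) - ip i p\<bar> \<le> (\<Sum>j\<in>A. \<bar>h * sqrt (boost j p) * gram i j * sg X j\<bar>)"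
    unfolding ip_step by (simp add: sum_abs)
  also have "\<dots> \<le> (\<Sum>j\<in>A. h * sqrt (1 + Z))"
  proof (intro sum_mono)
    fix j assume "j \<in> A"
    then have "\<bar>gram i j\<bar> \<le> 1" using assms gram_le by simp
    moreover have "\<bar>sg X j\<bar> = 1" by (simp add: sg_def)
    ultimately have "\<bar>h * sqrt (boost j p) * gram i j * sg X j\<bar> \<le> h * sqrt (boost j p) * 1"
      using pos boost_bounds[of j p] by (simp add: abs_mult mult_left_le)
    also have "\<dots> \<le> h * sqrt (1 + Z)"
      using pos boost_bounds[of j p] by simp
    finally show "\<bar>h * sqrt (boost j p) * gram i j * sg X j\<bar> \<le> h * sqrt (1 + Z)" .
  qed
  also have "\<dots> \<le> w" using h_small by (simp add: mult_ac)
  finally show ?thesis .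
qed

section \<open>Calculus of expectations along the walk\<close>

lemma avg_const: "avg (\<lambda>_. c) p = c"
  by (simp add: avg_def pexp_const fin)

lemma avg_cong: "(\<And>p. f p = g p) \<Longrightarrow> avg f p = avg g p"
  by (simp add: avg_def)

lemma avg_add: "avg (\<lambda>p. f p + g p) p = avg f p + avg g p"
  by (simp add: avg_def pexp_add)

lemma avg_cmult: "avg (\<lambda>p. c * f p) p = c * avg f p"
  by (simp add: avg_def pexp_cmult)

lemma avg_sum: "avg (\<lambda>p. \<Sum>i\<in>I. f i p) p = (\<Sum>i\<in>I. avg (f i) p)"
  by (simp add: avg_def pexp_sum)

lemma avg_mono: "(\<And>p. f p \<le> g p) \<Longrightarrow> avg f p \<le> avg g p"
  unfolding avg_def by (intro pexp_mono) auto

lemma avg_le_const: "(\<And>p. f p \<le> c) \<Longrightarrow> avg f p \<le> c"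
  using avg_mono[of f "\<lambda>_. c" p] by (simp add: avg_const)

lemma avg_ge_const: "(\<And>p. c \<le> f p) \<Longrightarrow> c \<le> avg f p"
  using avg_mono[of "\<lambda>_. c" f p] by (simp add: avg_const)

lemma iter_mono: "(\<And>p. f p \<le> g p) \<Longrightarrow> (avg ^^ m) f p \<le> (avg ^^ m) g p"
  by (induction m arbitrary: p) (auto intro: avg_mono)

lemma iter_affine: "(avg ^^ m) (\<lambda>p. c + d * f p) p = c + d * (avg ^^ m) f p"
proof (induction m arbitrary: p)
  case (Suc m)
  have "(avg ^^ Suc m) (\<lambda>p. c + d * f p) p = avg (\<lambda>p. c + d * (avg ^^ m) f p) p"
    unfolding funpow.simps o_def by (rule avg_cong) (rule Suc)
  then show ?case by (simp add: avg_add avg_const avg_cmult)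
qed simp

lemma acc_const: "acc (\<lambda>_. c) m p = m * c"
proof (induction m arbitrary: p)
  case (Suc m)
  from avg_cong[OF Suc] show ?case by (simp add: avg_const algebra_simps)
qed simp

lemma acc_add: "acc (\<lambda>p. f p + g p) m p = acc f m p + acc g m p"
proof (induction m arbitrary: p)
  case (Suc m)
  from avg_cong[OF Suc] show ?case by (simp add: avg_add)
qed simp

lemma acc_cmult: "acc (\<lambda>p. c * f p) m p = c * acc f m p"
proof (induction m arbitrary: p)
  case (Suc m)
  from avg_cong[OF Suc] show ?case by (simp add: avg_cmult algebra_simps)
qed simp

lemma acc_sum: "acc (\<lambda>p. \<Sum>i\<in>I. f i p) m p = (\<Sum>i\<in>I. acc (f i) m p)"
proof (induction m arbitrary: p)
  case (Suc m)
  from avg_cong[OF Suc] show ?case by (simp add: avg_sum sum.distrib)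
qed simp

lemma acc_mono: "(\<And>p. f p \<le> g p) \<Longrightarrow> acc f m p \<le> acc g m p"
  by (induction m arbitrary: p) (auto intro!: avg_mono add_mono)

lemma acc_nonneg: "(\<And>p. 0 \<le> f p) \<Longrightarrow> 0 \<le> acc f m p"
  using acc_mono[of "\<lambda>_. 0" f m p] by (simp add: acc_const)

lemma acc_eq_sum: "acc f m p = (\<Sum>t<m. (avg ^^ t) f p)"
proof (induction m arbitrary: p)
  case (Suc m)
  then have "acc f m = (\<lambda>p. \<Sum>t<m. (avg ^^ t) f p)" by auto
  then show ?case by (simp add: avg_sum sum.lessThan_Suc_shift del: sum.lessThan_Suc)
qed simp

lemma exists_le_average:
  assumes "acc f m p \<le> real m * c" "m > 0"
  shows "\<exists>p. f p \<le> c"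
proof (rule ccontr)
  assume "\<not> ?thesis"
  then have gt: "c < f p" for p by (simp add: not_le)
  obtain m' where m': "m = Suc m'" using assms(2) gr0_implies_Suc by blast
  have "m' * c \<le> avg (acc f m') p"
  proof (rule avg_ge_const)
    fix p show "m' * c \<le> acc f m' p"
      using acc_mono[of "\<lambda>_. c" f m' p] gt by (simp add: acc_const less_imp_le)
  qed
  with assms(1) gt[of p] show False by (simp add: m' algebra_simps)
qed

text \<open>A discrete Dynkin formula: a lower bound on the drift of \<open>F\<close> is summed
  along the walk. The next lemma is its counterpart for an upper bound.\<close>

lemma acc_le_iter:
  assumes "\<And>p. F p + f p \<le> avg F p"
  shows "F p + acc f m p \<le> (avg ^^ m) F p"
proof (induction m arbitrary: p)
  case (Suc m)
  have "F p + acc f (Suc m) p \<le> avg F p + avg (acc f m) p"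
    using assms[of p] by simp
  also have "\<dots> = avg (\<lambda>p. F p + acc f m p) p" by (simp add: avg_add)
  also have "\<dots> \<le> avg ((avg ^^ m) F) p" using Suc by (rule avg_mono)
  finally show ?case by simp
qed simp

lemma iter_le_acc:
  assumes "\<And>p. avg F p \<le> F p + f p"
  shows "(avg ^^ m) F p \<le> F p + acc f m p"
proof (induction m arbitrary: p)
  case (Suc m)
  have "avg ((avg ^^ m) F) p \<le> avg (\<lambda>p. F p + acc f m p) p" using Suc by (rule avg_mono)
  also have "\<dots> = avg F p + avg (acc f m) p" by (simp add: avg_add)
  also have "\<dots> \<le> F p + acc f (Suc m) p"
    using assms[of p] by simp
  finally show ?case by simp
qed simp

section \<open>Time spent near a hyperplane\<close>

lemma avg_square: "avg (\<lambda>p'. (ip i p' - c)\<^sup>2) p = (ip i p - c)\<^sup>2 + h\<^sup>2 * qvar i p"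
proof -
  have eq: "ip i (step p X) - c = (ip i p - c) + (\<Sum>j\<in>A. (h * sqrt (boost j p) * gram i j) * (sg X j - 0))" for X
    by (simp add: ip_step)
  have "(\<Sum>j\<in>A. (h * sqrt (boost j p) * gram i j)\<^sup>2 * (1 - 0\<^sup>2)) = h\<^sup>2 * qvar i p"
    unfolding qvar_def sum_distrib_left
    by (intro sum.cong refl) (simp add: power_mult_distrib boost_nonneg)
  then show ?thesis
    unfolding avg_def eq pexp_square[OF fin(1), of "\<lambda>_. 0"] by simp
qed

text \<open>Convexity makes the drift nonnegative everywhere. Near the hyperplane a step is at most
  \<open>w\<close>, so both ends stay within \<open>2 * w\<close>, where the potential is quadratic
  and gains exactly half the variance of the step.\<close>

lemma avg_huber:
  assumes "i \<in> A"
  shows "huber (2 * w) (ip i p - b i) + h\<^sup>2 * qvar i p * of_bool (near i p) / 2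
    \<le> avg (\<lambda>p. huber (2 * w) (ip i p - b i)) p"
proof -
  define y where "y = ip i p - b i"
  define d where "d X = ip i (step p X) - ip i p" for X
  have d0: "pexp (\<lambda>_. 0) A d = 0"
    using pexp_linear[OF fin(1), of "\<lambda>_. 0" 0 "\<lambda>j. h * sqrt (boost j p) * gram i j"]
    by (simp add: d_def[abs_def] ip_step)
  have d2: "pexp (\<lambda>_. 0) A (\<lambda>X. (d X)\<^sup>2) = h\<^sup>2 * qvar i p"
    using avg_square[of i "ip i p" p] by (simp add: avg_def d_def)
  have "huber (2 * w) y + clip (2 * w) y * d X + of_bool (near i p) / 2 * (d X)\<^sup>2 \<le> huber (2 * w) (y + d X)" for X
  proof (cases "near i p")
    case True
    then have "\<bar>y\<bar> \<le> w" "\<bar>d X\<bar> \<le> w" using ip_step_small[OF assms] by (auto simp: near_def y_def d_def)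
    then have "\<bar>y\<bar> \<le> 2 * w" "\<bar>y + d X\<bar> \<le> 2 * w" by linarith+
    then show ?thesis using True by (simp add: huber_quadratic power2_eq_square field_simps)
  next
    case False
    then show ?thesis using huber_tangent[of "2 * w" y "d X"] pos by simp
  qed
  then have "pexp (\<lambda>_. 0) A (\<lambda>X. huber (2 * w) y + clip (2 * w) y * d X + of_bool (near i p) / 2 * (d X)\<^sup>2)
      \<le> pexp (\<lambda>_. 0) A (\<lambda>X. huber (2 * w) (y + d X))"
    by (intro pexp_mono) auto
  also have "\<dots> = avg (\<lambda>p. huber (2 * w) (ip i p - b i)) p"
    by (simp add: avg_def y_def d_def)
  finally show ?thesis
    by (simp only: pexp_add pexp_cmult pexp_const[OF fin(1)] d0 d2) (simp add: y_def mult_ac)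
qed

text \<open>The potential gains at least half the variance accumulated in the slab. It grows at most
  by \<open>2 * w\<close> times the mean displacement across the hyperplane, which is at most
  \<open>s\<close> since the mean squared displacement is at most \<open>s\<^sup>2\<close>.\<close>

lemma occupation:
  assumes i: "i \<in> A" and s: "s > 0" "acc (\<lambda>p. h\<^sup>2 * qvar i p) m p \<le> s\<^sup>2"
  shows "acc (\<lambda>p. h\<^sup>2 * qvar i p * of_bool (near i p)) m p \<le> 4 * w * s"
proof -
  let ?H = "\<lambda>p. huber (2 * w) (ip i p - b i)"
  have "?H p + acc (\<lambda>p. 1 / 2 * (h\<^sup>2 * qvar i p * of_bool (near i p))) m p \<le> (avg ^^ m) ?H p"
    using avg_huber[OF i] by (intro acc_le_iter) simp
  also have "\<dots> \<le> (avg ^^ m) (\<lambda>p'. ?H p + 2 * w * (s / 2 + 1 / (2 * s) * (ip i p' - ip i p)\<^sup>2)) p"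
  proof (rule iter_mono)
    fix p'
    have "?H p' - ?H p \<le> 2 * w * \<bar>ip i p' - ip i p\<bar>"
      using huber_lipschitz[of "2 * w" "ip i p' - b i" "ip i p - b i"] pos by simp
    also have "\<dots> \<le> 2 * w * (s / 2 + 1 / (2 * s) * (ip i p' - ip i p)\<^sup>2)"
      using abs_le_add_square[OF s(1), of "ip i p' - ip i p"] pos by (intro mult_left_mono) auto
    finally show "?H p' \<le> ?H p + 2 * w * (s / 2 + 1 / (2 * s) * (ip i p' - ip i p)\<^sup>2)" by simp
  qed
  also have "\<dots> = ?H p + 2 * w * (s / 2 + 1 / (2 * s) * (avg ^^ m) (\<lambda>p'. (ip i p' - ip i p)\<^sup>2) p)"
    by (simp only: iter_affine)
  also have "\<dots> \<le> ?H p + 2 * w * (s / 2 + 1 / (2 * s) * s\<^sup>2)"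
  proof -
    have "(avg ^^ m) (\<lambda>p'. (ip i p' - ip i p)\<^sup>2) p \<le> (ip i p - ip i p)\<^sup>2 + acc (\<lambda>p. h\<^sup>2 * qvar i p) m p"
      by (intro iter_le_acc) (simp add: avg_square)
    then have "(avg ^^ m) (\<lambda>p'. (ip i p' - ip i p)\<^sup>2) p \<le> s\<^sup>2" using s(2) by simp
    then show ?thesis using pos s(1) by (intro add_left_mono mult_left_mono) auto
  qed
  also have "\<dots> = ?H p + 2 * w * s" using s(1) by (simp add: power2_eq_square field_simps)
  finally show ?thesis by (simp only: acc_cmult)
qed

lemma acc_qvar: "acc (\<lambda>p. h\<^sup>2 * qvar i p) m p = (\<Sum>j\<in>A. (gram i j)\<^sup>2 * acc (\<lambda>p. h\<^sup>2 * boost j p) m p)"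
  by (simp add: qvar_def acc_sum[symmetric] acc_cmult[symmetric] sum_distrib_left mult_ac)

lemma acc_qvar_le:
  assumes "\<And>j. j \<in> A \<Longrightarrow> acc (\<lambda>p. h\<^sup>2 * boost j p) m p \<le> c"
  shows "acc (\<lambda>p. h\<^sup>2 * qvar i p) m p \<le> corr i * c"
  unfolding acc_qvar corr_def sum_distrib_right using assms by (intro sum_mono mult_left_mono) auto

lemma qvar_ge: 
  assumes "i \<in> A"
  shows "boost i p \<le> qvar i p" "corr i \<le> qvar i p"
proof -
  have "(gram i i)\<^sup>2 * boost i p \<le> qvar i p"
    unfolding qvar_def using fin assms boost_nonneg
    by (intro member_le_sum[of i A "\<lambda>j. (gram i j)\<^sup>2 * boost j p"]) auto
  then show "boost i p \<le> qvar i p" using gram_self[OF assms] by simp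
  show "corr i \<le> qvar i p"
    unfolding corr_def qvar_def
  proof (intro sum_mono)
    fix j
    show "(gram i j)\<^sup>2 \<le> (gram i j)\<^sup>2 * boost j p"
      using mult_left_mono[OF boost_bounds(1)[of j p], of "(gram i j)\<^sup>2"] by simp
  qed
qed

text \<open>A boosted hyperplane sees variance at least \<open>Z\<close> while near. The total
  variance across it is at most \<open>3 * T * corr i\<close>, hence at most the square of
  \<open>s = T / (4 * w)\<close>; then \<open>4 * w * s = T\<close>.\<close>

lemma acc_near_small:
  assumes i: "i \<in> A" "48 * w\<^sup>2 * corr i \<le> T"
    and le: "\<And>j. j \<in> A \<Longrightarrow> acc (\<lambda>p. h\<^sup>2 * boost j p) m p \<le> 3 * T"
  shows "Z * acc (\<lambda>p. h\<^sup>2 * of_bool (near i p)) m p \<le> T"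
proof -
  have "Z * (h\<^sup>2 * of_bool (near i p)) \<le> h\<^sup>2 * qvar i p * of_bool (near i p)" for p
    using qvar_ge(1)[OF i(1), of p] i(2) pos by (auto simp: boost_def)
  then have "acc (\<lambda>p. Z * (h\<^sup>2 * of_bool (near i p))) m p \<le> acc (\<lambda>p. h\<^sup>2 * qvar i p * of_bool (near i p)) m p"
    by (rule acc_mono)
  also have "\<dots> \<le> 4 * w * (T / (4 * w))"
  proof (rule occupation[OF i(1)])
    have "acc (\<lambda>p. h\<^sup>2 * qvar i p) m p \<le> corr i * (3 * T)" by (rule acc_qvar_le[OF le])
    also have "\<dots> = (48 * w\<^sup>2 * corr i) * T / (16 * w\<^sup>2)" using pos by (simp add: field_simps)
    also have "\<dots> \<le> T * T / (16 * w\<^sup>2)" using pos i(2) by (intro divide_right_mono mult_right_mono) auto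
    finally show "acc (\<lambda>p. h\<^sup>2 * qvar i p) m p \<le> (T / (4 * w))\<^sup>2"
      by (simp add: power2_eq_square)
  qed (use pos in auto)
  finally show ?thesis using pos by (simp add: acc_cmult)
qed

text \<open>A bootstrap: one more step spoils the bound \<open>2 * T\<close> to at most
  \<open>3 * T\<close>, from which \<open>acc_near_small\<close> recovers
  \<open>2 * T\<close>.\<close>

lemma acc_boost_le:
  assumes "m * h\<^sup>2 \<le> T" "j \<in> A"
  shows "acc (\<lambda>p. h\<^sup>2 * boost j p) m p \<le> 2 * T"
  using assms
proof (induction m arbitrary: p j)
  case 0
  then show ?case using pos by simp
next
  case (Suc m)
  have mT: "m * h\<^sup>2 \<le> T"
    using Suc.prems(1) by (rule order.trans[rotated]) (auto intro!: mult_right_mono)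
  have bnd: "acc (\<lambda>p. h\<^sup>2 * boost j p) (Suc m) p \<le> 3 * T" if "j \<in> A" for j
  proof -
    have "avg (acc (\<lambda>p. h\<^sup>2 * boost j p) m) p \<le> 2 * T"
      using Suc.IH[OF mT that] by (rule avg_le_const)
    moreover have "h\<^sup>2 * boost j p \<le> T"
      using h_small(2) boost_bounds(2)[of j p] by (meson mult_left_mono order.trans zero_le_power2)
    ultimately show ?thesis by simp
  qed
  show ?case
  proof (cases "48 * w\<^sup>2 * corr j \<le> T")
    case True
    then have "(\<lambda>p. h\<^sup>2 * boost j p) = (\<lambda>p. h\<^sup>2 + Z * (h\<^sup>2 * of_bool (near j p)))"
      by (auto simp: boost_def algebra_simps)
    then have "acc (\<lambda>p. h\<^sup>2 * boost j p) (Suc m) p = Suc m * h\<^sup>2 + Z * acc (\<lambda>p. h\<^sup>2 * of_bool (near j p)) (Suc m) p"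
      by (simp only: acc_add acc_const acc_cmult)
    also have "\<dots> \<le> T + T"
      using Suc.prems acc_near_small[OF _ True bnd] by (intro add_mono) auto
    finally show ?thesis by simp
  next
    case False
    then have "(\<lambda>p. h\<^sup>2 * boost j p) = (\<lambda>p. h\<^sup>2)" by (auto simp: boost_def)
    then have "acc (\<lambda>p. h\<^sup>2 * boost j p) (Suc m) p = Suc m * h\<^sup>2" by (simp only: acc_const)
    then show ?thesis using Suc.prems pos by simp
  qed
qed

text \<open>Hyperplanes that can be boosted are near for time at most \<open>T / Z\<close>. For the
  others the variance across the slab is at least \<open>corr i\<close> per unit of time, and
  \<open>occupation\<close> gives the other summand.\<close>

lemma acc_near_le:
  assumes m: "m * h\<^sup>2 \<le> T" and i: "i \<in> A"
  shows "acc (\<lambda>p. h\<^sup>2 * of_bool (near i p)) m p \<le> 40 * w\<^sup>2 + T / Z"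
proof (cases "48 * w\<^sup>2 * corr i \<le> T")
  case True
  have "acc (\<lambda>p. h\<^sup>2 * boost j p) m p \<le> 3 * T" if "j \<in> A" for j
    using acc_boost_le[OF m that, of p] pos by simp
  from acc_near_small[OF i True this] have "acc (\<lambda>p. h\<^sup>2 * of_bool (near i p)) m p \<le> T / Z"
    using pos by (simp add: field_simps)
  then show ?thesis by (simp add: add_increasing)
next
  case False
  \<comment> \<open>The total variance is at most \<open>2 * T * corr i\<close>, hence at most 96 *
    (w * corr i)^2, rounded up to \<open>s\<^sup>2\<close>.\<close>
  define s where "s = 10 * w * corr i"
  have c: "corr i > 0"
  proof -
    have "0 < T" using pos by simp
    also have "T < 48 * w\<^sup>2 * corr i" using False by simp
    finally show ?thesis by (simp add: zero_less_mult_iff)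
  qed
  have "corr i * (h\<^sup>2 * of_bool (near i p)) \<le> h\<^sup>2 * qvar i p * of_bool (near i p)" for p
    using qvar_ge(2)[OF i, of p] pos by (auto simp: mult.commute)
  then have "corr i * acc (\<lambda>p. h\<^sup>2 * of_bool (near i p)) m p \<le> acc (\<lambda>p. h\<^sup>2 * qvar i p * of_bool (near i p)) m p"
    by (subst acc_cmult[symmetric]) (rule acc_mono)
  also have "\<dots> \<le> 4 * w * s"
  proof (rule occupation[OF i])
    have "acc (\<lambda>p. h\<^sup>2 * qvar i p) m p \<le> corr i * (2 * T)"
      using acc_boost_le[OF m] by (rule acc_qvar_le)
    also have "\<dots> \<le> corr i * (2 * (48 * w\<^sup>2 * corr i))"
      using False c by (intro mult_left_mono) auto
    also have "\<dots> \<le> s\<^sup>2"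
      using zero_le_power2[of "w * corr i"] by (simp add: s_def power2_eq_square mult_ac)
    finally show "acc (\<lambda>p. h\<^sup>2 * qvar i p) m p \<le> s\<^sup>2" .
  qed (use pos c in \<open>auto simp: s_def\<close>)
  also have "\<dots> = corr i * (40 * w\<^sup>2)" by (simp add: s_def power2_eq_square)
  finally have "acc (\<lambda>p. h\<^sup>2 * of_bool (near i p)) m p \<le> 40 * w\<^sup>2" using c by simp
  then show ?thesis using pos by (simp add: add_increasing2)
qed

section \<open>Exponential moments of the coordinates\<close>

lemma avg_cosh_le: 
  "avg (\<lambda>p. cosh (c * p l)) p \<le> cosh (c * p l) * exp (c\<^sup>2 * (h\<^sup>2 * cvar l p) / 2)"
proof -
  have e: "pexp (\<lambda>_. 0) A (\<lambda>X. exp (c' * step p X l)) \<le> exp (c' * p l) * exp (c\<^sup>2 * (h\<^sup>2 * cvar l p) / 2)"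
    if "c' = c \<or> c' = - c" for c'
  proof -
    let ?d = "\<lambda>j. c' * (h * sqrt (boost j p) * v j l)"
    have eq: "exp (c' * step p X l) = exp (c' * p l) * exp (\<Sum>j\<in>A. ?d j * (sg X j - 0))" for X
      by (simp add: step_def exp_add[symmetric] distrib_left sum_distrib_left mult_ac)
    have "(\<Sum>j\<in>A. (?d j)\<^sup>2) = c\<^sup>2 * (h\<^sup>2 * cvar l p)"
      unfolding cvar_def sum_distrib_left using that
      by (intro sum.cong refl) (auto simp: power_mult_distrib boost_nonneg)
    moreover have "pexp (\<lambda>_. 0) A (\<lambda>X. exp (\<Sum>j\<in>A. ?d j * (sg X j - 0))) \<le> exp ((\<Sum>j\<in>A. (?d j)\<^sup>2) / 2)"
      using pexp_exp_le[OF fin(1), of "\<lambda>_. 0"] by simp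
    ultimately show ?thesis unfolding eq pexp_cmult by simp
  qed
  have "avg (\<lambda>p. cosh (c * p l)) p =
      1 / 2 * (pexp (\<lambda>_. 0) A (\<lambda>X. exp (c * step p X l)) + pexp (\<lambda>_. 0) A (\<lambda>X. exp (- c * step p X l)))"
    by (simp add: avg_def cosh_def pexp_cmult[symmetric] pexp_add[symmetric])
  also have "\<dots> \<le> 1 / 2 * (exp (c * p l) * exp (c\<^sup>2 * (h\<^sup>2 * cvar l p) / 2) + exp (- c * p l) * exp (c\<^sup>2 * (h\<^sup>2 * cvar l p) / 2))"
    by (intro mult_left_mono add_mono e) auto
  also have "\<dots> = cosh (c * p l) * exp (c\<^sup>2 * (h\<^sup>2 * cvar l p) / 2)"
    by (simp add: cosh_def algebra_simps)
  finally show ?thesis .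
qed

fun expacc :: "(('l \<Rightarrow> real) \<Rightarrow> real) \<Rightarrow> nat \<Rightarrow> ('l \<Rightarrow> real) \<Rightarrow> real" where
  "expacc f 0 p = 1"
| "expacc f (Suc m) p = exp (f p) * avg (expacc f m) p"

text \<open>Khasminskii's lemma: \<open>1 + 2 * acc f m\<close> is a supersolution of the recursion for the expectation
  of \<open>exp\<close> of the accumulated \<open>f\<close>.\<close>

lemma expacc_le:
  assumes "\<And>p. 0 \<le> f p" "\<And>t p. t \<le> m \<Longrightarrow> acc f t p \<le> 1 / 4"
  shows "expacc f m p \<le> 1 + 2 * acc f m p"
  using assms(2)
proof (induction m arbitrary: p)
  case (Suc m)
  define x B where "x = f p" and "B = avg (acc f m) p"
  have x: "0 \<le> x" and B: "0 \<le> B" "x + B \<le> 1 / 4"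
    using assms(1)[of p] Suc.prems[of "Suc m" p] acc_nonneg[OF assms(1)]
    by (auto simp: x_def B_def intro!: avg_ge_const)
  have "expacc f (Suc m) p \<le> exp x * avg (\<lambda>p. 1 + 2 * acc f m p) p"
    using Suc by (auto simp: x_def intro!: avg_mono)
  also have "\<dots> = exp x * (1 + 2 * B)" by (simp add: avg_add avg_const avg_cmult B_def)
  also have "\<dots> \<le> (1 + x + x\<^sup>2) * (1 + 2 * B)"
    using x B exp_bound[of x] by (intro mult_right_mono) auto
  also have "\<dots> \<le> 1 + 2 * (x + B)"
  proof -
    have "x\<^sup>2 \<le> x * (1 / 4)" unfolding power2_eq_square using x B by (intro mult_left_mono) auto
    moreover have "x * B \<le> x * (1 / 4)" using x B by (intro mult_left_mono) auto
    moreover have "x\<^sup>2 * B \<le> x\<^sup>2 * (1 / 4)" using x B by (intro mult_left_mono) auto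
    ultimately show ?thesis using x by (simp add: algebra_simps)
  qed
  finally show ?case by (simp add: x_def B_def)
qed simp

text \<open>An application of the Cauchy-Schwarz inequality, split by the free parameter \<open>s\<close> so that it can be
  carried through the induction.\<close>

lemma iter_cosh_le:
  assumes "s > 0"
  shows "(avg ^^ m) (\<lambda>p. cosh (\<theta> * p l)) p
    \<le> (s * cosh (2 * \<theta> * p l) + expacc (\<lambda>p. 2 * \<theta>\<^sup>2 * (h\<^sup>2 * cvar l p)) m p / s) / 2"
  using assms
proof (induction m arbitrary: p s)
  case 0
  have "cosh (\<theta> * p l) ^ 2 \<le> cosh (2 * \<theta> * p l)"
    using cosh_double_cosh[of "\<theta> * p l"] cosh_real_ge_1[of "\<theta> * p l"] power_mono[of 1 "cosh (\<theta> * p l)" 2]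
    by (simp add: mult.assoc)
  then have "s * cosh (\<theta> * p l) ^ 2 \<le> s * cosh (2 * \<theta> * p l)" using 0 by simp
  moreover have "2 * cosh (\<theta> * p l) \<le> s * cosh (\<theta> * p l) ^ 2 + 1 / s"
  proof -
    have "0 \<le> (s * cosh (\<theta> * p l) - 1)\<^sup>2 / s" using 0 by simp
    also have "\<dots> = s * cosh (\<theta> * p l) ^ 2 + 1 / s - 2 * cosh (\<theta> * p l)"
      using 0 by (simp add: power2_eq_square field_simps)
    finally show ?thesis by simp
  qed
  ultimately show ?case by simp
next
  case (Suc m)
  define e where "e = 2 * \<theta>\<^sup>2 * (h\<^sup>2 * cvar l p)"
  \<comment> \<open>Chosen to cancel the growth factor \<open>exp e\<close> of the
    \<open>cosh\<close> term; the same factor reappears in the \<open>expacc\<close> term, matching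
    its recursion.\<close>
  define s' where "s' = s * exp (- e)"
  have s': "s' > 0" using Suc.prems by (simp add: s'_def)
  let ?u = "expacc (\<lambda>p. 2 * \<theta>\<^sup>2 * (h\<^sup>2 * cvar l p))"
  have "(avg ^^ Suc m) (\<lambda>p. cosh (\<theta> * p l)) p \<le>
      avg (\<lambda>p. (s' / 2) * cosh (2 * \<theta> * p l) + 1 / (2 * s') * ?u m p) p"
    unfolding funpow.simps o_def using Suc.IH[OF s'] by (intro avg_mono) (simp add: field_simps)
  also have "\<dots> = s' / 2 * avg (\<lambda>p. cosh (2 * \<theta> * p l)) p + 1 / (2 * s') * avg (?u m) p"
    by (simp only: avg_add avg_cmult)
  also have "\<dots> \<le> s' / 2 * (cosh (2 * \<theta> * p l) * exp e) + 1 / (2 * s') * avg (?u m) p"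
    using avg_cosh_le[of "2 * \<theta>" l p] s'
    by (intro add_right_mono mult_left_mono) (auto simp: e_def power2_eq_square mult_ac)
  also have "\<dots> = (s * cosh (2 * \<theta> * p l) + ?u (Suc m) p / s) / 2"
  proof -
    have 1: "s' * exp e = s" "1 / s' = exp e / s"
      using Suc.prems by (simp_all add: s'_def exp_minus field_simps)
    have 2: "?u (Suc m) p = exp e * avg (?u m) p" by (simp add: e_def)
    have "s' / 2 * (cosh (2 * \<theta> * p l) * exp e) + 1 / (2 * s') * avg (?u m) p
        = (s' * exp e * cosh (2 * \<theta> * p l) + 1 / s' * avg (?u m) p) / 2"
      by (simp add: field_simps)
    then show ?thesis unfolding 1 2 by simp
  qed
  finally show ?case .
qed

text \<open>The column bound and \<open>acc_boost_le\<close> keep the accumulated exponent at most 4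
  * \<theta>^2 * \<kappa> * T \<le> 1/4, so \<open>expacc_le\<close> gives 3/2. Starting at the
  origin with \<open>s = 1\<close> yields (1 + 3/2) / 2 \<le> 2.\<close>

lemma iter_cosh_le_2:
  assumes m: "m * h\<^sup>2 \<le> T" and cols: "(\<Sum>j\<in>A. (v j l)\<^sup>2) \<le> \<kappa>" and \<theta>: "16 * \<theta>\<^sup>2 * \<kappa> * T \<le> 1"
  shows "(avg ^^ m) (\<lambda>p. cosh (\<theta> * p l)) (\<lambda>_. 0) \<le> 2"
proof -
  let ?f = "\<lambda>p. 2 * \<theta>\<^sup>2 * (h\<^sup>2 * cvar l p)"
  have cv: "0 \<le> cvar l p" for p
    unfolding cvar_def using boost_nonneg by (intro sum_nonneg) auto
  have le: "acc ?f t p \<le> 1 / 4" if "t \<le> m" for t p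
  proof -
    have t: "t * h\<^sup>2 \<le> T"
      using m that by (meson mult_right_mono of_nat_mono order.trans zero_le_power2)
    have "acc ?f t p = 2 * \<theta>\<^sup>2 * (\<Sum>j\<in>A. (v j l)\<^sup>2 * acc (\<lambda>p. h\<^sup>2 * boost j p) t p)"
      by (simp add: cvar_def acc_sum[symmetric] acc_cmult[symmetric] sum_distrib_left mult_ac)
    also have "\<dots> \<le> 2 * \<theta>\<^sup>2 * (\<Sum>j\<in>A. (v j l)\<^sup>2 * (2 * T))"
      using acc_boost_le[OF t] by (intro mult_left_mono sum_mono) auto
    also have "\<dots> = 4 * \<theta>\<^sup>2 * T * (\<Sum>j\<in>A. (v j l)\<^sup>2)" by (subst sum_distrib_right[symmetric]) simp
    also have "\<dots> \<le> 4 * \<theta>\<^sup>2 * T * \<kappa>" using cols pos by (intro mult_left_mono) auto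
    also have "\<dots> \<le> 1 / 4" using \<theta> by (simp add: mult_ac)
    finally show ?thesis .
  qed
  have "expacc ?f m (\<lambda>_. 0) \<le> 1 + 2 * acc ?f m (\<lambda>_. 0)"
    using le cv by (intro expacc_le) auto
  also have "\<dots> \<le> 3 / 2" using le[of m "\<lambda>_. 0"] by simp
  finally have "expacc ?f m (\<lambda>_. 0) \<le> 3 / 2" .
  then show ?thesis using iter_cosh_le[of 1 m \<theta> l "\<lambda>_. 0"] by simp
qed

end

text \<open>Average the cost, near hyperplanes plus penalized large coordinates, along the walk from
  the origin; some point does no worse. With
  \<open>T = 1 / (16 * \<theta>\<^sup>2 * \<kappa>)\<close> a hyperplane is near for a fraction
  \<open>40 * w\<^sup>2 / T + 1 / Z\<close> of the time at most.\<close>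

lemma exists_drift:
  fixes v :: "'i \<Rightarrow> 'l \<Rightarrow> real" and \<kappa> w \<theta> Z \<Gamma> :: real
  assumes fin: "finite A" "finite S"
    and unit: "\<And>i. i \<in> A \<Longrightarrow> (\<Sum>l\<in>S. (v i l)\<^sup>2) = 1"
    and cols: "\<And>l. l \<in> S \<Longrightarrow> (\<Sum>i\<in>A. (v i l)\<^sup>2) \<le> \<kappa>"
    and params: "\<kappa> > 0" "w > 0" "\<theta> > 0" "Z > 0" "\<Gamma> \<ge> 0"
  shows "\<exists>p. card {i \<in> A. \<bar>(\<Sum>l\<in>S. v i l * p l) - b i\<bar> \<le> w} + \<Gamma> * (\<Sum>l\<in>S. cosh (\<theta> * p l))
    \<le> card A * (640 * w\<^sup>2 * \<theta>\<^sup>2 * \<kappa> + 1 / Z) + \<Gamma> * (2 * card S)"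
proof -
  define T where "T = 1 / (16 * \<theta>\<^sup>2 * \<kappa>)"
  have T: "T > 0" using params by (simp add: T_def)
  \<comment> \<open>So many steps that \<open>h\<^sup>2 = T / m\<close> meets both smallness
    conditions of the walk.\<close>
  obtain m :: nat where m: "m > max (1 + Z) (T * (real (card A))\<^sup>2 * (1 + Z) / w\<^sup>2)"
    using reals_Archimedean2 by blast
  then have m0: "real m > 0" using params by linarith
  define h where "h = sqrt (T / m)"
  have h: "h > 0" "h\<^sup>2 = T / m" using T m0 by (auto simp: h_def)
  have h1: "h * card A * sqrt (1 + Z) \<le> w"
  proof -
    have "(h * card A * sqrt (1 + Z))\<^sup>2 = T * (real (card A))\<^sup>2 * (1 + Z) / m"
      using params by (simp add: power_mult_distrib h)
    also have "\<dots> \<le> w\<^sup>2"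
    proof -
      have "T * (real (card A))\<^sup>2 * (1 + Z) / w\<^sup>2 \<le> m" using m by simp
      then have "T * (real (card A))\<^sup>2 * (1 + Z) \<le> m * w\<^sup>2"
        using params by (subst (asm) pos_divide_le_eq) auto
      then show ?thesis using m0 by (subst pos_divide_le_eq) (auto simp: mult.commute)
    qed
    finally show ?thesis by (rule power2_le_imp_le) (use params in auto)
  qed
  have "T * (1 + Z) \<le> T * m" using m T by (intro mult_left_mono) auto
  then have "T * (1 + Z) / m \<le> T" using m0 by (subst pos_divide_le_eq) auto
  then have h2: "h\<^sup>2 * (1 + Z) \<le> T" unfolding h(2) by simp
  interpret slab_walk A S v b w Z T h
    by (rule slab_walk.intro) (fact fin unit params T h(1) h1 h2)+
  have mT: "m * h\<^sup>2 \<le> T" using m0 by (simp add: h)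
  define C where "C p = (\<Sum>i\<in>A. of_bool (near i p)) + \<Gamma> * (\<Sum>l\<in>S. cosh (\<theta> * p l))" for p
  define c where "c = card A * (640 * w\<^sup>2 * \<theta>\<^sup>2 * \<kappa> + 1 / Z) + \<Gamma> * (2 * card S)"
  have near_le: "acc (\<lambda>p. of_bool (near i p)) m (\<lambda>_. 0) \<le> m * (640 * w\<^sup>2 * \<theta>\<^sup>2 * \<kappa> + 1 / Z)" if "i \<in> A" for i
  proof -
    have "(T / m) * acc (\<lambda>p. of_bool (near i p)) m (\<lambda>_. 0) \<le> 40 * w\<^sup>2 + T / Z"
      using acc_near_le[OF mT that] by (simp only: acc_cmult h)
    then have "(m / T) * ((T / m) * acc (\<lambda>p. of_bool (near i p)) m (\<lambda>_. 0)) \<le> (m / T) * (40 * w\<^sup>2 + T / Z)"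
      using T by (intro mult_left_mono) auto
    also have "(m / T) * ((T / m) * acc (\<lambda>p. of_bool (near i p)) m (\<lambda>_. 0)) = acc (\<lambda>p. of_bool (near i p)) m (\<lambda>_. 0)"
      using T m0 by simp
    also have "(m / T) * (40 * w\<^sup>2 + T / Z) = m * (40 * w\<^sup>2 / T + 1 / Z)"
      using T by (simp add: distrib_left)
    finally have "acc (\<lambda>p. of_bool (near i p)) m (\<lambda>_. 0) \<le> m * (40 * w\<^sup>2 / T + 1 / Z)" .
    also have "40 * w\<^sup>2 / T = 640 * w\<^sup>2 * \<theta>\<^sup>2 * \<kappa>" by (simp add: T_def)
    finally show ?thesis .
  qed
  have cosh_le: "acc (\<lambda>p. cosh (\<theta> * p l)) m (\<lambda>_. 0) \<le> m * 2" if "l \<in> S" for l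
  proof -
    have "(avg ^^ t) (\<lambda>p. cosh (\<theta> * p l)) (\<lambda>_. 0) \<le> 2" if "t < m" for t
    proof (rule iter_cosh_le_2[OF _ cols[OF \<open>l \<in> S\<close>]])
      have "real t * h\<^sup>2 \<le> m * h\<^sup>2" using that by (intro mult_right_mono) auto
      then show "real t * h\<^sup>2 \<le> T" using mT by simp
      show "16 * \<theta>\<^sup>2 * \<kappa> * T \<le> 1" using params by (simp add: T_def)
    qed
    then have "acc (\<lambda>p. cosh (\<theta> * p l)) m (\<lambda>_. 0) \<le> (\<Sum>t<m. 2)"
      unfolding acc_eq_sum by (intro sum_mono) auto
    then show ?thesis by simp
  qed
  have "acc C m (\<lambda>_. 0) = (\<Sum>i\<in>A. acc (\<lambda>p. of_bool (near i p)) m (\<lambda>_. 0)) +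
      \<Gamma> * (\<Sum>l\<in>S. acc (\<lambda>p. cosh (\<theta> * p l)) m (\<lambda>_. 0))"
    unfolding C_def by (simp only: acc_add acc_sum acc_cmult)
  also have "\<dots> \<le> (\<Sum>i\<in>A. m * (640 * w\<^sup>2 * \<theta>\<^sup>2 * \<kappa> + 1 / Z)) + \<Gamma> * (\<Sum>l\<in>S. real m * 2)"
    using near_le cosh_le params by (intro add_mono mult_left_mono sum_mono) auto
  also have "\<dots> = m * c" by (simp add: c_def algebra_simps)
  finally obtain p where "C p \<le> c" using exists_le_average[of C m "\<lambda>_. 0" c] m0 by auto
  moreover have "(\<Sum>i\<in>A. of_bool (near i p)) = real (card {i \<in> A. \<bar>(\<Sum>l\<in>S. v i l * p l) - b i\<bar> \<le> w})"
    using fin by (simp add: near_def ip_def Int_def sum.If_cases of_bool_def)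
  ultimately show ?thesis by (auto simp: C_def c_def)
qed


section \<open>Counting sliced edges\<close>

text \<open>Fixing the signs on \<open>D\<close> to \<open>X0\<close> only shifts the offset, and
  dividing the equation by \<open>r > 0\<close> preserves sides.\<close>

lemma pivotal_restrict:
  fixes n :: nat
  assumes "D \<subseteq> {..<n}" "X0 \<subseteq> D" "X \<subseteq> {..<n} - D" "l \<in> {..<n} - D" "r > 0"
  shows "pivotal a b {..<n} l (X \<union> X0) \<longleftrightarrow>
    pivotal (\<lambda>l. a l / r) ((b - (\<Sum>l\<in>D. a l * sg X0 l)) / r) ({..<n} - D) l X"
proof -
  define S where "S = {..<n} - D"
  define d where "d = (\<Sum>l\<in>D. a l * sg X0 l)"
  have U: "{..<n} = S \<union> D" "S \<inter> D = {}" "finite S" "finite D"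
    using assms(1) finite_subset[OF assms(1) finite_lessThan] by (auto simp: S_def)
  have split: "(\<Sum>j\<in>{..<n}. a j * sg (Y \<union> X0) j) = (\<Sum>j\<in>S. a j * sg Y j) + d" if "Y \<subseteq> S" for Y
    unfolding U(1) d_def using that assms(2) U by (intro sum_sg_Un) auto
  have eq: "insert l (X \<union> X0) = insert l X \<union> X0" "(X \<union> X0) - {l} = (X - {l}) \<union> X0"
    using assms by auto
  have scale: "(\<Sum>j\<in>S. a j / r * sg Y j) - (b - d) / r = ((\<Sum>j\<in>S. a j * sg Y j) + d - b) / r" for Y
    by (simp add: diff_divide_distrib add_divide_distrib sum_divide_distrib)
  have sub: "insert l X \<subseteq> S" "X - {l} \<subseteq> S" using assms by (auto simp: S_def)
  show ?thesis
    unfolding pivotal_def S_def[symmetric] d_def[symmetric] eq split[OF sub(1)] split[OF sub(2)] scale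
    using assms(5) by (auto simp: mult_less_0_iff divide_less_0_iff zero_less_divide_iff)
qed

lemma not_pivotal_dead:
  fixes n :: nat
  assumes "D \<subseteq> {..<n}" "X0 \<subseteq> D" "X \<subseteq> {..<n} - D" "l \<in> {..<n} - D"
    and dead: "(\<forall>l\<in>{..<n} - D. a l = 0) \<or> \<bar>(\<Sum>l\<in>D. a l * sg X0 l) - b\<bar> > (\<Sum>l\<in>{..<n} - D. \<bar>a l\<bar>)"
  shows "\<not> pivotal a b {..<n} l (X \<union> X0)"
proof -
  define S where "S = {..<n} - D"
  define d where "d = (\<Sum>l\<in>D. a l * sg X0 l)"
  have "pivotal a b {..<n} l (X \<union> X0) \<longleftrightarrow> pivotal (\<lambda>l. a l / 1) ((b - d) / 1) S l X"
    unfolding S_def d_def using assms by (intro pivotal_restrict) auto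
  moreover have "\<not> pivotal a (b - d) S l X"
    using dead
  proof
    assume "\<forall>l\<in>{..<n} - D. a l = 0"
    then have "(\<Sum>j\<in>S. a j * sg Y j) = 0" for Y by (auto simp: S_def)
    then show ?thesis by (auto simp: pivotal_def mult_less_0_iff)
  next
    assume "\<bar>(\<Sum>l\<in>D. a l * sg X0 l) - b\<bar> > (\<Sum>l\<in>{..<n} - D. \<bar>a l\<bar>)"
    then have *: "\<bar>d - b\<bar> > (\<Sum>l\<in>S. \<bar>a l\<bar>)" by (simp add: d_def S_def)
    show ?thesis
      using * abs_sum_sg_le[of a "insert l X" S] abs_sum_sg_le[of a "X - {l}" S]
      by (auto simp: pivotal_def mult_less_0_iff)
  qed
  ultimately show ?thesis by simp
qed

text \<open>Count the sliced edges at a random vertex of mean \<open>p\<close> in the remaining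
  subcube. All \<open>card S\<close> edges are sliced, far hyperplanes account for at most a quarter
  of them, and each of the at most \<open>K\<close> near ones for at most
  \<open>3 * sqrt (card S)\<close> on average.\<close>

lemma slicing_inequality:
  fixes a :: "'i \<Rightarrow> nat \<Rightarrow> real" and \<kappa> :: real
  assumes I: "finite I" "card I < 2 ^ T" "card I \<le> n" and n: "n \<ge> 2"
    and \<kappa>: "\<kappa> > 0" "\<kappa> * n \<ge> 2 * card I * (real T * (2 * ln n + 2) + 1)"
    and K: "card I * (640 * (2 + sqrt (8 * ln n))\<^sup>2 * (2 * ln (2 * (real n)\<^sup>2))\<^sup>2 * \<kappa> + 1 / n) + 2 \<le> K" "K < n"
    and all_sliced: "\<And>X l. X \<subseteq> {..<n} \<Longrightarrow> l < n \<Longrightarrow> \<exists>i\<in>I. pivotal (a i) (b i) {..<n} l X"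
  shows "sqrt (n / 2) \<le> 4 * K"
proof -
  obtain D X0 J where D: "D \<subseteq> {..<n}" "2 * card D \<le> n" "X0 \<subseteq> D" and J: "J \<subseteq> I"
    "\<And>i. i \<in> J \<Longrightarrow> sqsum (a i) ({..<n} - D) > 0"
    "\<And>l. l \<in> {..<n} - D \<Longrightarrow> (\<Sum>i\<in>J. (a i l)\<^sup>2 / sqsum (a i) ({..<n} - D)) \<le> \<kappa>"
    "\<And>i. i \<in> I - J \<Longrightarrow> (\<forall>l\<in>{..<n} - D. a i l = 0) \<or>
       \<bar>(\<Sum>l\<in>D. a i l * sg X0 l) - b i\<bar> > (\<Sum>l\<in>{..<n} - D. \<bar>a i l\<bar>)"
    by (rule remove_dominant_coordinates[OF I(1,2) _ \<kappa>, of a b]) (use n in auto)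
  define S where "S = {..<n} - D"
  define r where "r i = sqrt (sqsum (a i) S)" for i
  define v where "v i l = a i l / r i" for i l
  define c where "c i = (b i - (\<Sum>l\<in>D. a i l * sg X0 l)) / r i" for i
  have fin: "finite J" "finite S" using J(1) I(1) finite_subset by (auto simp: S_def)
  have cS: "card S \<le> n" "n \<le> 2 * card S"
    using D card_mono[of "{..<n}" S] card_Diff_subset[OF finite_subset[OF D(1) finite_lessThan] D(1)]
    by (auto simp: S_def)
  have r: "r i > 0" "(r i)\<^sup>2 = sqsum (a i) S" if "i \<in> J" for i
    using J(2)[OF that] by (auto simp: r_def S_def)
  have unit: "(\<Sum>l\<in>S. (v i l)\<^sup>2) = 1" if "i \<in> J" for i
    using J(2)[OF that] r[OF that]
    by (simp add: v_def power_divide sum_divide_distrib[symmetric] sqsum_def[symmetric] S_def)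
  have cols: "(\<Sum>i\<in>J. (v i l)\<^sup>2) \<le> \<kappa>" if "l \<in> S" for l
    using J(3)[of l] that r by (simp add: v_def power_divide S_def cong: sum.cong)
  \<comment> \<open>The summand 2 absorbs the distance from a pivotal vertex to the hyperplane, and
    the root makes the tail 2 / n^4. The choice of \<open>\<theta>\<close> gives exp (\<theta> / 2)
    = 2 * n^2, so one coordinate beyond 1/2 would cost at least n^2 in \<open>cosh\<close>.\<close>
  define w where "w = 2 + sqrt (8 * ln n)"
  define \<theta> where "\<theta> = 2 * ln (2 * (real n)\<^sup>2)"
  have ln0: "ln n \<ge> 0" using n by simp
  have n2: "1 < 2 * (real n)\<^sup>2"
  proof -
    have "1 \<le> (real n)\<^sup>2" by (rule one_le_power) (use n in simp)
    then show ?thesis by linarith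
  qed
  have pos: "w > 0" "\<theta> > 0" "real n > 0" using ln0 n n2 by (auto simp: w_def \<theta>_def add_pos_nonneg)
  \<comment> \<open>The boost is \<open>Z = n\<close> and the penalty weight \<open>1 / n\<close>,
    so the penalty on the right is at most 2.\<close>
  obtain p where p: "card {i \<in> J. \<bar>(\<Sum>l\<in>S. v i l * p l) - c i\<bar> \<le> w} + 1 / n * (\<Sum>l\<in>S. cosh (\<theta> * p l))
      \<le> card J * (640 * w\<^sup>2 * \<theta>\<^sup>2 * \<kappa> + 1 / n) + 1 / n * (2 * card S)"
    using exists_drift[OF fin unit cols \<kappa>(1) pos, of "1 / n" c] by auto
  define near where "near = {i \<in> J. \<bar>(\<Sum>l\<in>S. v i l * p l) - c i\<bar> \<le> w}"
  have "card J * (640 * w\<^sup>2 * \<theta>\<^sup>2 * \<kappa> + 1 / n) + 1 / n * (2 * card S) \<le>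
      card I * (640 * w\<^sup>2 * \<theta>\<^sup>2 * \<kappa> + 1 / n) + 2"
  proof (intro add_mono mult_right_mono)
    show "real (card J) \<le> real (card I)" using card_mono[OF I(1) J(1)] by simp
    show "1 / n * (2 * card S) \<le> 2" using cS(1) pos by (simp add: field_simps)
  qed (use \<kappa> in auto)
  also have "\<dots> \<le> K" using K(1) by (simp add: w_def \<theta>_def)
  finally have pK: "card near + 1 / n * (\<Sum>l\<in>S. cosh (\<theta> * p l)) \<le> K"
    using p by (simp add: near_def)
  have nearK: "card near \<le> K"
  proof -
    have "0 \<le> 1 / n * (\<Sum>l\<in>S. cosh (\<theta> * p l))"
      using cosh_real_nonneg by (intro mult_nonneg_nonneg sum_nonneg) auto
    then show ?thesis using pK by linarith
  qed
  have p_half: "\<bar>p l\<bar> \<le> 1 / 2" if l: "l \<in> S" for l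
  proof (rule ccontr)
    assume "\<not> ?thesis"
    then have "\<theta> / 2 \<le> \<bar>\<theta> * p l\<bar>" using pos by (simp add: abs_mult)
    then have "cosh (\<theta> / 2) \<le> cosh (\<theta> * p l)"
      using pos cosh_real_nonneg_le_iff[of "\<theta> / 2" "\<bar>\<theta> * p l\<bar>"] by simp
    moreover have "exp (\<theta> / 2) / 2 \<le> cosh (\<theta> / 2)"
      by (simp add: cosh_def)
    moreover have "exp (\<theta> / 2) = 2 * (real n)\<^sup>2" using n by (simp add: \<theta>_def)
    moreover have "cosh (\<theta> * p l) \<le> (\<Sum>l\<in>S. cosh (\<theta> * p l))"
      using l fin by (intro member_le_sum) auto
    ultimately have "(real n)\<^sup>2 \<le> (\<Sum>l\<in>S. cosh (\<theta> * p l))" by linarith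
    then have "real n \<le> 1 / n * (\<Sum>l\<in>S. cosh (\<theta> * p l))"
      using pos by (simp add: field_simps power2_eq_square)
    then show False using pK K(2) by linarith
  qed
  then have p1: "\<bar>p l\<bar> \<le> 1" if "l \<in> S" for l using that by force
  define P where "P i l = pexp p S (\<lambda>X. of_bool (pivotal (v i) (c i) S l X))" for i l
  have covered: "1 \<le> (\<Sum>i\<in>J. of_bool (pivotal (v i) (c i) S l X) :: real)" if "l \<in> S" "X \<subseteq> S" for l X
  proof -
    have "X \<union> X0 \<subseteq> {..<n}" "l < n" using that D by (auto simp: S_def)
    then obtain i where i: "i \<in> I" "pivotal (a i) (b i) {..<n} l (X \<union> X0)" using all_sliced by blast
    have "i \<in> J"
      using i not_pivotal_dead[OF D(1,3), of X l "a i" "b i"] J(4)[of i] that unfolding S_def by blast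
    moreover from this have "pivotal (v i) (c i) S l X"
      using pivotal_restrict[OF D(1,3), of X l "r i" "a i" "b i"] i(2) that r(1)
      unfolding v_def[abs_def] c_def S_def by blast
    ultimately show ?thesis
      using member_le_sum[of i J "\<lambda>i. of_bool (pivotal (v i) (c i) S l X) :: real"] fin by auto
  qed
  have far: "P i l \<le> 2 / real n ^ 4" if i: "i \<in> J - near" and l: "l \<in> S" for i l
  proof -
    have "P i l \<le> pexp p S (\<lambda>X. of_bool (\<bar>\<Sum>l\<in>S. v i l * (sg X l - p l)\<bar> \<ge> w - 2))"
      unfolding P_def
    proof (intro pexp_mono p1)
      fix X
      have "\<bar>\<Sum>l\<in>S. v i l * (sg X l - p l)\<bar> \<ge> w - 2" if piv: "pivotal (v i) (c i) S l X"
      proof -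
        have "(v i l)\<^sup>2 \<le> 1" using sq_le_sqsum[OF fin(2) l, of "v i"] unit[of i] i by (simp add: sqsum_def)
        then have "\<bar>v i l\<bar> \<le> 1" by (simp add: abs_square_le_1)
        then have "\<bar>(\<Sum>l\<in>S. v i l * sg X l) - c i\<bar> \<le> 2"
          using pivotal_imp_abs_less[OF fin(2) l piv] by simp
        moreover have "\<bar>(\<Sum>l\<in>S. v i l * p l) - c i\<bar> > w" using i by (auto simp: near_def)
        moreover have "(\<Sum>l\<in>S. v i l * (sg X l - p l)) = (\<Sum>l\<in>S. v i l * sg X l) - (\<Sum>l\<in>S. v i l * p l)"
          by (simp add: right_diff_distrib sum_subtractf)
        ultimately show ?thesis by linarith
      qed
      then show "of_bool (pivotal (v i) (c i) S l X) \<le>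
          (of_bool (\<bar>\<Sum>l\<in>S. v i l * (sg X l - p l)\<bar> \<ge> w - 2) :: real)" by simp
    qed
    also have "\<dots> \<le> 2 * exp (- (w - 2)\<^sup>2 / 2)"
      using fin p1 unit[of i] i ln0 by (intro pexp_tail_le) (auto simp: w_def)
    also have "exp (- (w - 2)\<^sup>2 / 2) = 1 / real n ^ 4"
    proof -
      have "- (w - 2)\<^sup>2 / 2 = - (4 * ln n)" using ln0 by (simp add: w_def)
      moreover have "exp (4 * ln n) = real n ^ 4" using pos exp_of_nat_mult[of 4 "ln n"] by simp
      ultimately show ?thesis by (simp add: exp_minus inverse_eq_divide)
    qed
    finally show ?thesis by simp
  qed
  have "card S = (\<Sum>l\<in>S. pexp p S (\<lambda>_. 1))" by (simp add: pexp_const fin)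
  also have "\<dots> \<le> (\<Sum>l\<in>S. pexp p S (\<lambda>X. \<Sum>i\<in>J. of_bool (pivotal (v i) (c i) S l X)))"
    using covered p1 by (intro sum_mono pexp_mono) auto
  also have "\<dots> = (\<Sum>l\<in>S. \<Sum>i\<in>J. P i l)"
    by (simp only: pexp_sum P_def)
  also have "\<dots> = (\<Sum>i\<in>J. \<Sum>l\<in>S. P i l)" by (rule sum.swap)
  also have "\<dots> = (\<Sum>i\<in>J - near. \<Sum>l\<in>S. P i l) + (\<Sum>i\<in>near. \<Sum>l\<in>S. P i l)"
    using fin by (intro sum.subset_diff) (auto simp: near_def)
  also have "\<dots> \<le> (\<Sum>i\<in>J - near. \<Sum>l\<in>S. 2 / real n ^ 4) + (\<Sum>i\<in>near. 3 * sqrt (card S))"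
    using far expected_pivotal_le[OF fin(2) p_half] unfolding P_def by (intro add_mono sum_mono) auto
  also have "\<dots> \<le> card S / 4 + 3 * sqrt (card S) * K"
  proof (rule add_mono)
    have "card (J - near) \<le> n"
      using card_mono[OF I(1), of "J - near"] J(1) I(3) by (meson Diff_subset order.trans)
    then have "(\<Sum>i\<in>J - near. \<Sum>l\<in>S. 2 / real n ^ 4) \<le> n * (card S * (2 / real n ^ 4))"
      by (simp only: sum_constant) (intro mult_right_mono, auto)
    also have "\<dots> = card S * (2 / real n ^ 3)" using pos by (simp add: field_simps power_numeral_reduce)
    also have "\<dots> \<le> card S * (1 / 4)"
    proof (intro mult_left_mono)
      have "(2::real) ^ 3 \<le> real n ^ 3" using n by (intro power_mono) auto
      then show "2 / real n ^ 3 \<le> 1 / 4" using pos by (simp add: field_simps)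
    qed auto
    finally show "(\<Sum>i\<in>J - near. \<Sum>l\<in>S. 2 / real n ^ 4) \<le> card S / 4" by simp
    show "(\<Sum>i\<in>near. 3 * sqrt (card S)) \<le> 3 * sqrt (card S) * K"
      using mult_right_mono[OF nearK, of "3 * sqrt (card S)"] by (simp add: mult_ac)
  qed
  finally have "card S \<le> 4 * sqrt (card S) * K" by simp
  then have "sqrt (card S) * sqrt (card S) \<le> sqrt (card S) * (4 * K)" by (simp add: mult_ac)
  moreover have "sqrt (card S) > 0" using cS n by auto
  ultimately have "sqrt (card S) \<le> 4 * K" by (subst (asm) mult_le_cancel_left_pos)
  moreover have "sqrt (n / 2) \<le> sqrt (card S)" using cS(2) by simp
  ultimately show ?thesis by linarith
qed

section \<open>Choice of parameters and asymptotics\<close>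

text \<open>The value of \<open>K\<close> for x^(13/19) hyperplanes, with the
  \<open>\<kappa>\<close> needed for deleting at most half of the coordinates. Up to logarithms it
  is of order x^(2 * 13/19 - 1) = x^(7/19), hence below the square root.\<close>

definition near_bound :: "real \<Rightarrow> real" where
  "near_bound x = x powr (13/19) * (640 * (2 + sqrt (8 * ln x))\<^sup>2 * (2 * ln (2 * x\<^sup>2))\<^sup>2 *
     (2 * x powr (13/19) * ((2 * ln x + 2) * (2 * ln x + 2) + 1) / x) + 1 / x) + 2"

lemma near_bound_eventually_small:
  "eventually (\<lambda>x. near_bound x < x \<and> 4 * near_bound x < sqrt (x / 2)) at_top"
proof (rule eventually_conj)
  show "eventually (\<lambda>x. near_bound x < x) at_top"
    unfolding near_bound_def by real_asymp
  show "eventually (\<lambda>x. 4 * near_bound x < sqrt (x / 2)) at_top"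
    unfolding near_bound_def by real_asymp
qed

lemma card_gt_powr:
  assumes n: "n \<ge> 3" "near_bound n < n" "4 * near_bound n < sqrt (n / 2)"
    and I: "finite I"
    and all_sliced: "\<And>X l. X \<subseteq> {..<n} \<Longrightarrow> l < n \<Longrightarrow> \<exists>i\<in>I. pivotal (a i) (b i) {..<n} l X"
  shows "real (card I) > real n powr (13/19)"
proof (rule ccontr)
  assume "\<not> ?thesis"
  then have le: "real (card I) \<le> real n powr (13/19)" by simp
  also have "\<dots> \<le> real n powr 1" using n by (intro powr_mono) auto
  finally have cn: "card I \<le> n" by simp
  \<comment> \<open>Since exp (1/2) \<le> 2, having \<open>T > 2 * ln n\<close> suffices for
    \<open>n < 2 ^ T\<close>.\<close>
  define T where "T = nat \<lceil>2 * ln (real n)\<rceil> + 1"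
  have ln0: "ln (real n) \<ge> 0" using n by simp
  have T: "2 * ln n < real T" "real T \<le> 2 * ln n + 2"
    using ln0 by (auto simp: T_def) linarith+
  have "real n < 2 ^ T"
  proof -
    have "real n = exp (ln n)" using n by simp
    also have "\<dots> < exp (real T * (1 / 2))" using T by simp
    also have "\<dots> = exp (1 / 2) ^ T" by (rule exp_of_nat_mult)
    also have "\<dots> \<le> 2 ^ T" using exp_bound_half[of "1 / 2 :: real"] by (intro power_mono) auto
    finally show ?thesis .
  qed
  then have "real (card I) < real (2 ^ T)" using cn by simp
  then have cT: "card I < 2 ^ T" by (rule of_nat_less_imp_less)
  define \<kappa> where "\<kappa> = 2 * real n powr (13/19) * ((2 * ln n + 2) * (2 * ln n + 2) + 1) / n"
  have \<kappa>0: "\<kappa> > 0" unfolding \<kappa>_def using n ln0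
    by (intro divide_pos_pos mult_pos_pos add_nonneg_pos) auto
  have \<kappa>: "2 * card I * (real T * (2 * ln n + 2) + 1) \<le> \<kappa> * n"
  proof -
    have "2 * card I * (real T * (2 * ln n + 2) + 1) \<le>
        2 * real n powr (13/19) * ((2 * ln n + 2) * (2 * ln n + 2) + 1)"
      using le T ln0 by (intro mult_mono add_mono) auto
    also have "\<dots> = \<kappa> * n" using n by (simp add: \<kappa>_def)
    finally show ?thesis .
  qed
  have "sqrt (n / 2) \<le> 4 * near_bound n"
  proof (rule slicing_inequality[OF I cT cn _ \<kappa>0 \<kappa> _ n(2) all_sliced])
    have "card I * (640 * (2 + sqrt (8 * ln n))\<^sup>2 * (2 * ln (2 * (real n)\<^sup>2))\<^sup>2 * \<kappa> + 1 / n) + 2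
        \<le> real n powr (13/19) * (640 * (2 + sqrt (8 * ln n))\<^sup>2 * (2 * ln (2 * (real n)\<^sup>2))\<^sup>2 * \<kappa> + 1 / n) + 2"
      using le \<kappa>0 by (intro add_right_mono mult_right_mono add_nonneg_nonneg mult_nonneg_nonneg) auto
    then show "card I * (640 * (2 + sqrt (8 * ln n))\<^sup>2 * (2 * ln (2 * (real n)\<^sup>2))\<^sup>2 * \<kappa> + 1 / n) + 2 \<le> near_bound n"
      by (simp add: near_bound_def \<kappa>_def)
  qed (use n in auto)
  then show False using n(3) by simp
qed

section \<open>From hyperplanes in space to threshold functions\<close>

lemma slices_imp_pivotal:
  assumes a: "a \<in> carrier_vec n" "a \<noteq> 0\<^sub>v n"
    and slices: "slices n (hyperplane n a b) (vec n (sg (insert l X))) (vec n (sg (X - {l})))"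
  shows "pivotal (vec_index a) b {..<n} l X"
proof -
  have "a \<bullet> vec n f = (\<Sum>j\<in>{..<n}. vec_index a j * f j)" for f
    by (simp add: scalar_prod_def atLeast0LessThan)
  then show ?thesis
    using slices unfolding slices_hyperplane_iff[OF a vec_carrier vec_carrier]
    by (auto simp: pivotal_def mult_less_0_iff sgn_if split: if_splits)
qed

lemma cube_edge_sg:
  assumes "l < n"
  shows "cube_edge n (vec n (sg (insert l X))) (vec n (sg (X - {l})))"
proof -
  have "{i. i < n \<and> vec_index (vec n (sg (insert l X))) i \<noteq> vec_index (vec n (sg (X - {l}))) i} = {l}"
    using assms by (auto simp: sg_def split: if_splits)
  then show ?thesis
    unfolding cube_edge_def cube_vertices_def by (simp add: sg_def)
qed

theorem theorem1p1:
  shows "\<exists>N. \<forall>n\<ge>N. \<forall>\<H> :: real vec set set.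
    finite \<H> \<longrightarrow> (\<forall>H\<in>\<H>. is_hyperplane n H) \<longrightarrow> slices_all_cube_edges n \<H> \<longrightarrow>
    real (card \<H>) > real n powr (13/19) / (10 ^ 11 * ln (real n) powr (32/19))"
proof -
  have "eventually (\<lambda>n::nat. near_bound n < n \<and> 4 * near_bound n < sqrt (n / 2)) at_top"
    using near_bound_eventually_small filterlim_real_sequentially by (rule eventually_compose_filterlim)
  then obtain N where N: "\<And>n. n \<ge> N \<Longrightarrow> near_bound (real n) < real n \<and> 4 * near_bound (real n) < sqrt (real n / 2)"
    by (auto simp: eventually_at_top_linorder)
  show ?thesis
  proof (intro exI[of _ "max N 3"] allI impI)
    fix n and \<H> :: "real vec set set"
    assume n: "max N 3 \<le> n" and fin: "finite \<H>" and hyp: "\<forall>H\<in>\<H>. is_hyperplane n H"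
      and sl: "slices_all_cube_edges n \<H>"
    obtain a b where ab: "\<And>H. H \<in> \<H> \<Longrightarrow> a H \<in> carrier_vec n \<and> a H \<noteq> 0\<^sub>v n \<and> H = hyperplane n (a H) (b H)"
      using hyp unfolding is_hyperplane_def by metis
    have "real n powr (13/19) < real (card \<H>)"
    proof (rule card_gt_powr[of n \<H> "\<lambda>H. vec_index (a H)" b])
      fix X l assume l: "l < n"
      then obtain H where "H \<in> \<H>" "slices n H (vec n (sg (insert l X))) (vec n (sg (X - {l})))"
        using sl cube_edge_sg unfolding slices_all_cube_edges_def by blast
      then show "\<exists>H\<in>\<H>. pivotal (vec_index (a H)) (b H) {..<n} l X"
        using slices_imp_pivotal ab by metis
    qed (use n N fin in auto)
    \<comment> \<open>For n \<ge> 3 > e the logarithm is at least 1, so the denominator is at least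
      1 and the bound already shown is stronger.\<close>
    moreover have "real n powr (13/19) / (10 ^ 11 * ln (real n) powr (32/19)) \<le> real n powr (13/19) / 1"
    proof -
      have "exp 1 \<le> real n" using n e_less_272 by linarith
      then have "1 \<le> ln (real n)" using n by (subst ln_ge_iff) auto
      then have "1 \<le> ln (real n) powr (32/19)" by (rule ge_one_powr_ge_zero) auto
      then have "1 \<le> 10 ^ 11 * ln (real n) powr (32/19)" by simp
      then show ?thesis by (intro divide_left_mono) auto
    qed
    ultimately show "real n powr (13/19) / (10 ^ 11 * ln (real n) powr (32/19)) < real (card \<H>)" by simp
  qed
qed

end
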